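(* We have the bound $$[M^m:\pi_{q^m}(\mathrm{TA}_n(\mathbb{F}_q))]\leq 2^{\sigma_0(m)}\prod_{d\mid m}d,$$ where $M^m:=\pi_{q^m}(\mathrm{MA}_n(\mathbb{F}_q))\cap \mathrm{Perm}(\mathbb{F}_{q^m}^n)$ and $\sigma_0(m)$ is the number of divisors of $m$.
   Context: $n\geq 3$ and $q$ is a prime power. $\mathrm{MA}_n(\mathbb{F}_q)$ is the monoid of polynomial maps $\mathbb{F}_q[X_1,\dots,X_n]^n$; $\mathrm{TA}_n(\mathbb{F}_q)$ is the tame automorphism group, generated by invertible affine maps and triangular maps $(a_1X_1+f_1,\dots,a_nX_n+f_n)$ with $a_i\in\mathbb{F}_q^*$, $f_i\in\mathbb{F}_q[X_{i+1},\dots,X_n]$. $\pi_{q^m}$ sends a polynomial map to the induced map $\mathbb{F}_{q^m}^n\to\mathbb{F}_{q^m}^n$. Thus $M^m$ is the set of permutations of $\mathbb{F}_{q^m}^n$ induced by polynomial endomorphisms over $\mathbb{F}_q$ (equivalently, permutations commuting with $\mathrm{Gal}(\mathbb{F}_{q^m}:\mathbb{F}_q)$). *)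

theory Defs
  imports "HOL-Library.Poly_Mapping" "HOL-Algebra.Bij" "HOL-Algebra.Coset"
    "HOL-Computational_Algebra.Primes"
begin

type_synonym 'a mpoly = "(nat \<Rightarrow>\<^sub>0 nat) \<Rightarrow>\<^sub>0 'a"

definition poly_eval :: "('a::zero \<Rightarrow> 'b::comm_ring_1) \<Rightarrow> 'a mpoly \<Rightarrow> (nat \<Rightarrow> 'b) \<Rightarrow> 'b" where
  "poly_eval phi p x =
     (\<Sum>mo\<in>Poly_Mapping.keys p. phi (Poly_Mapping.lookup p mo) * (\<Prod>i\<in>Poly_Mapping.keys mo. x i ^ Poly_Mapping.lookup mo i))"

definition mconst :: "'a::zero \<Rightarrow> 'a mpoly" where
  "mconst c = Poly_Mapping.single 0 c"

definition mvar :: "nat \<Rightarrow> 'a::{zero,one} mpoly" where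
  "mvar i = Poly_Mapping.single (Poly_Mapping.single i 1) 1"

definition mvars :: "'a::zero mpoly \<Rightarrow> nat set" where
  "mvars p = \<Union> (Poly_Mapping.keys ` Poly_Mapping.keys p)"

definition poly_over :: "'a::zero set \<Rightarrow> nat set \<Rightarrow> 'a mpoly \<Rightarrow> bool" where
  "poly_over K V p \<longleftrightarrow> (\<forall>mo. Poly_Mapping.lookup p mo \<in> K) \<and> mvars p \<subseteq> V"

text \<open>The subfield F_q of a finite field 'a of order q^m.\<close>
definition Fq :: "nat \<Rightarrow> 'a::field set" where
  "Fq q = {x. x ^ q = x}"

definition MA :: "nat \<Rightarrow> nat \<Rightarrow> (nat \<Rightarrow> 'a::field mpoly) set" where
  "MA n q = {F. (\<forall>i<n. poly_over (Fq q) {..<n} (F i)) \<and> (\<forall>i\<ge>n. F i = 0)}"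

definition pcomp :: "nat \<Rightarrow> (nat \<Rightarrow> 'a::comm_ring_1 mpoly) \<Rightarrow> (nat \<Rightarrow> 'a mpoly) \<Rightarrow> (nat \<Rightarrow> 'a mpoly)" where
  "pcomp n F G = (\<lambda>i. if i < n then poly_eval mconst (F i) G else 0)"

definition affine_maps :: "nat \<Rightarrow> nat \<Rightarrow> (nat \<Rightarrow> 'a::field mpoly) set" where
  "affine_maps n q = {F. \<exists>A B b.
      (\<forall>i j. A i j \<in> Fq q) \<and> (\<forall>i j. B i j \<in> Fq q) \<and> (\<forall>i. b i \<in> Fq q) \<and>
      (\<forall>i<n. \<forall>j<n. (\<Sum>k<n. A i k * B k j) = (if i = j then 1 else 0)) \<and>
      (\<forall>i<n. \<forall>j<n. (\<Sum>k<n. B i k * A k j) = (if i = j then 1 else 0)) \<and>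
      (\<forall>i. F i = (if i < n then (\<Sum>j<n. mconst (A i j) * mvar j) + mconst (b i) else 0))}"

definition triangular_maps :: "nat \<Rightarrow> nat \<Rightarrow> (nat \<Rightarrow> 'a::field mpoly) set" where
  "triangular_maps n q = {F. \<exists>a f.
      (\<forall>i<n. a i \<in> Fq q \<and> a i \<noteq> 0 \<and> poly_over (Fq q) {Suc i..<n} (f i)) \<and>
      (\<forall>i. F i = (if i < n then mconst (a i) * mvar i + f i else 0))}"

text \<open>TA_n(F_q): generated under composition by affine and triangular maps
  (both generating sets are closed under inversion and contain the identity,
  so the generated monoid is the generated group).\<close>
inductive_set TA :: "nat \<Rightarrow> nat \<Rightarrow> (nat \<Rightarrow> 'a::field mpoly) set" for n q where
  aff: "F \<in> affine_maps n q \<Longrightarrow> F \<in> TA n q"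
| tri: "F \<in> triangular_maps n q \<Longrightarrow> F \<in> TA n q"
| comp: "F \<in> TA n q \<Longrightarrow> G \<in> TA n q \<Longrightarrow> pcomp n F G \<in> TA n q"

definition Pts :: "nat \<Rightarrow> (nat \<Rightarrow> 'a) set" where
  "Pts n = PiE {..<n} (\<lambda>_. UNIV)"

definition induced :: "nat \<Rightarrow> (nat \<Rightarrow> 'a::field mpoly) \<Rightarrow> (nat \<Rightarrow> 'a) \<Rightarrow> (nat \<Rightarrow> 'a)" where
  "induced n F = (\<lambda>x\<in>Pts n. \<lambda>i\<in>{..<n}. poly_eval id (F i) x)"

definition Mm :: "nat \<Rightarrow> nat \<Rightarrow> ((nat \<Rightarrow> 'a::field) \<Rightarrow> (nat \<Rightarrow> 'a)) set" where
  "Mm n q = induced n ` MA n q \<inter> Bij (Pts n)"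

definition perm_index :: "nat \<Rightarrow> ((nat \<Rightarrow> 'a) \<Rightarrow> (nat \<Rightarrow> 'a)) set \<Rightarrow> ((nat \<Rightarrow> 'a) \<Rightarrow> (nat \<Rightarrow> 'a)) set \<Rightarrow> nat" where
  "perm_index n M H = card (rcosets\<^bsub>(BijGroup (Pts n))\<lparr>carrier := M\<rparr>\<^esub> H)"

definition sigma0 :: "nat \<Rightarrow> nat" where
  "sigma0 m = card {d. d dvd m}"

end

(* Every permutation in M^m commutes with the Frobenius and hence permutes, for each d dividing m,
   the Galois orbits of length d. Call a permutation a twisted 3-cycle if it moves only three such
   orbits, cyclically, and has order three. If H is a group of equivariant permutations
   containing all twisted 3-cycles on the points of degree d, then modulo H every equivariant
   permutation can be modified so that it fixes all points of degree d outside two fixed orbits,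
   those of a and b, and maps b to a or b; it is then determined by the image of a, for which there
   are at most 2 d choices.

   For the tame group, Lagrange interpolation (averaged over the Galois group) yields maps that add
   a prescribed value to one coordinate on a single line, and on its conjugates. Commutators of two
   such maps with intersecting lines are twisted 3-cycles. These are spread to all points of degree
   d by conjugation: every point of degree d is reached by elementary moves because, by counting
   subfields, some coordinate can always be moved to an element of larger degree. *)
theory Submission
  imports Defs "HOL-Number_Theory.Residues" "HOL-Computational_Algebra.Polynomial"
begin

section \<open>Twisted 3-cycles\<close>

text \<open>A twisted 3-cycle joins points, not orbits: replacing one of its points by a Galois
  conjugate gives a different permutation. Two such 3-cycles differ by a twist of one orbit against
  another, so relative twists can be removed, and in each degree d only a total twist (d values) and
  a swap of two orbits (factor 2) are left. The spreading therefore has to reach all conjugates of a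
  point too, which requires a seed containing a point together with its Frobenius conjugate. A
  second obstacle is collision: conjugating by a 3-cycle whose third point lies in an orbit already
  in use does not give the wanted cycle, so spare points in further orbits are kept in order to move
  that third point away. The condition n \<ge> 3 enters through the intersecting lines: each varies
  one coordinate, and a third coordinate, common to both, has to remember which Galois conjugate is
  meant. The permutation argument is made for an abstract cyclic action \<open>act\<close> and a set
  \<open>H\<close> closed under composition and inverses up to equality on \<open>X\<close>;
  polynomials enter only when the tame group is shown to be an instance.\<close>

locale equivariant_perms =
  fixes X :: "'p set" and act :: "nat \<Rightarrow> 'p \<Rightarrow> 'p" and m :: nat and H :: "('p \<Rightarrow> 'p) set"
  assumes m_pos: "m > 0"
    and act_closed [simp]: "x \<in> X \<Longrightarrow> act j x \<in> X"
    and act_0 [simp]: "x \<in> X \<Longrightarrow> act 0 x = x"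
    and act_add: "x \<in> X \<Longrightarrow> act (i + j) x = act i (act j x)"
    and act_m: "x \<in> X \<Longrightarrow> act m x = x"
    and H_closed [simp]: "h \<in> H \<Longrightarrow> x \<in> X \<Longrightarrow> h x \<in> X"
    and H_act: "h \<in> H \<Longrightarrow> x \<in> X \<Longrightarrow> h (act j x) = act j (h x)"
    and H_comp: "g \<in> H \<Longrightarrow> h \<in> H \<Longrightarrow> \<exists>k\<in>H. \<forall>x\<in>X. k x = g (h x)"
    and H_inv: "h \<in> H \<Longrightarrow> \<exists>k\<in>H. \<forall>x\<in>X. k (h x) = x \<and> h (k x) = x"
begin

definition orb :: "'p \<Rightarrow> 'p set" where
  "orb x = range (\<lambda>j. act j x)"

lemma act_mult_m: "x \<in> X \<Longrightarrow> act (k * m) x = x"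
  by (induction k) (auto simp: act_add act_m)

lemma act_inverse: "\<exists>i. \<forall>x\<in>X. act i (act j x) = x \<and> act j (act i x) = x"
proof (intro exI ballI)
  fix x assume x: "x \<in> X"
  \<comment> \<open>Exponents are natural numbers, so the inverse of the \<open>j\<close>-th power
    is the power \<open>j * (m - 1)\<close>.\<close>
  have "j * (m - 1) + j = j * m" "j + j * (m - 1) = j * m"
    using m_pos by (cases m; simp)+
  then show "act (j * (m - 1)) (act j x) = x \<and> act j (act (j * (m - 1)) x) = x"
    using x act_mult_m[of x j] by (metis act_add)
qed

lemma orb_act [simp]:
  assumes "x \<in> X" shows "orb (act j x) = orb x"
proof
  show "orb (act j x) \<subseteq> orb x"
    using assms by (auto simp: orb_def simp flip: act_add)
  obtain i where "act i (act j x) = x"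
    using act_inverse[of j] assms by auto
  then have "act k x = act (k + i) (act j x)" for k
    using assms by (simp add: act_add)
  then show "orb x \<subseteq> orb (act j x)"
    unfolding orb_def by blast
qed

lemma orb_eq_iff: "x \<in> X \<Longrightarrow> y \<in> X \<Longrightarrow> orb x = orb y \<longleftrightarrow> (\<exists>j. y = act j x)"
  by (metis act_0 orb_act orb_def rangeE rangeI)

lemma act_eq_iff: "x \<in> X \<Longrightarrow> y \<in> X \<Longrightarrow> act j x = act j y \<longleftrightarrow> x = y"
  by (metis act_inverse)

lemma H_eq_iff: "h \<in> H \<Longrightarrow> x \<in> X \<Longrightarrow> y \<in> X \<Longrightarrow> h x = h y \<longleftrightarrow> x = y"
  by (metis H_inv)

lemma orb_H: 
  assumes "h \<in> H" "x \<in> X" "y \<in> X" 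
  shows "orb (h x) = orb (h y) \<longleftrightarrow> orb x = orb y"
  using assms by (simp add: orb_eq_iff flip: H_act) (simp add: H_eq_iff)

lemma H_obtain_inv:
  assumes "h \<in> H"
  obtains k where "k \<in> H" "\<And>x. x \<in> X \<Longrightarrow> k (h x) = x" "\<And>x. x \<in> X \<Longrightarrow> h (k x) = x"
  using H_inv[OF assms] by blast

lemma H_obtain_comp:
  assumes "g \<in> H" "h \<in> H"
  obtains k where "k \<in> H" "\<And>x. x \<in> X \<Longrightarrow> k x = g (h x)"
  using H_comp[OF assms] by blast

text \<open>Elements of \<open>H\<close> commute with \<open>act\<close>, so \<open>cyc c x y z\<close> determines \<open>c\<close> on \<open>X\<close>: it cycles
  \<open>act j x\<close>, \<open>act j y\<close>, \<open>act j z\<close> for each \<open>j\<close> and fixes all other points.\<close>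

definition cyc :: "('p \<Rightarrow> 'p) \<Rightarrow> 'p \<Rightarrow> 'p \<Rightarrow> 'p \<Rightarrow> bool" where
  "cyc c x y z \<longleftrightarrow> c x = y \<and> c y = z \<and> c z = x \<and>
     (\<forall>p\<in>X. orb p \<noteq> orb x \<longrightarrow> orb p \<noteq> orb y \<longrightarrow> orb p \<noteq> orb z \<longrightarrow> c p = p)"

text \<open>The relation depends on the points and not only on their orbits:
  \<open>T x y (act j z)\<close> is in general a different assertion from \<open>T x y z\<close>.
  Passing from one to the other is the purpose of the twisting lemmas.\<close>

definition T :: "'p \<Rightarrow> 'p \<Rightarrow> 'p \<Rightarrow> bool" where
  "T x y z \<longleftrightarrow> x \<in> X \<and> y \<in> X \<and> z \<in> X \<and> orb x \<noteq> orb y \<and> orb y \<noteq> orb z \<and> orb x \<noteq> orb z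
     \<and> (\<exists>c\<in>H. cyc c x y z)"

lemma T_X: "T x y z \<Longrightarrow> x \<in> X" "T x y z \<Longrightarrow> y \<in> X" "T x y z \<Longrightarrow> z \<in> X"
  and T_orb: "T x y z \<Longrightarrow> orb x \<noteq> orb y" "T x y z \<Longrightarrow> orb y \<noteq> orb z" "T x y z \<Longrightarrow> orb x \<noteq> orb z"
    "T x y z \<Longrightarrow> orb y \<noteq> orb x" "T x y z \<Longrightarrow> orb z \<noteq> orb y" "T x y z \<Longrightarrow> orb z \<noteq> orb x"
  by (auto simp: T_def)

lemma T_obtain:
  assumes "T x y z"
  obtains c where "c \<in> H" "c x = y" "c y = z" "c z = x"
    "\<And>p. p \<in> X \<Longrightarrow> orb p \<noteq> orb x \<Longrightarrow> orb p \<noteq> orb y \<Longrightarrow> orb p \<noteq> orb z \<Longrightarrow> c p = p"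
  using assms by (auto simp: T_def cyc_def)

lemma T_rot: "T x y z \<Longrightarrow> T y z x"
  unfolding T_def cyc_def by metis

lemma T_rev:
  assumes "T x y z" shows "T x z y"
proof -
  obtain c where c: "c \<in> H" "c x = y" "c y = z" "c z = x"
    "\<And>p. p \<in> X \<Longrightarrow> orb p \<noteq> orb x \<Longrightarrow> orb p \<noteq> orb y \<Longrightarrow> orb p \<noteq> orb z \<Longrightarrow> c p = p"
    using T_obtain[OF assms] by metis
  obtain k where k: "k \<in> H" "\<And>x. x \<in> X \<Longrightarrow> k (c x) = x"
    using H_obtain_inv[OF c(1)] by metis
  have "cyc k x z y"
    unfolding cyc_def using k(2) c T_X[OF assms] by metis
  then show ?thesis
    using assms k(1) unfolding T_def by auto
qed

lemmas T_perms = T_rot T_rev T_rot[OF T_rot] T_rev[OF T_rot] T_rot[OF T_rev]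

lemma T_H:
  assumes h: "h \<in> H" and T: "T x y z" shows "T (h x) (h y) (h z)"
proof -
  note X = T_X[OF T]
  obtain c where c: "c \<in> H" "c x = y" "c y = z" "c z = x"
    "\<And>p. p \<in> X \<Longrightarrow> orb p \<noteq> orb x \<Longrightarrow> orb p \<noteq> orb y \<Longrightarrow> orb p \<noteq> orb z \<Longrightarrow> c p = p"
    using T_obtain[OF T] by metis
  obtain h' where h': "h' \<in> H" "\<And>x. x \<in> X \<Longrightarrow> h' (h x) = x" "\<And>x. x \<in> X \<Longrightarrow> h (h' x) = x"
    using H_obtain_inv[OF h] by metis
  obtain k where k: "k \<in> H" "\<And>x. x \<in> X \<Longrightarrow> k x = c (h' x)"
    using H_obtain_comp[OF c(1) h'(1)] by metis
  obtain l where l: "l \<in> H" "\<And>x. x \<in> X \<Longrightarrow> l x = h (k x)"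
    using H_obtain_comp[OF h k(1)] by metis
  have "l p = p" if "p \<in> X" "orb p \<noteq> orb (h x)" "orb p \<noteq> orb (h y)" "orb p \<noteq> orb (h z)" for p
  proof -
    have "orb (h' p) \<noteq> orb x" "orb (h' p) \<noteq> orb y" "orb (h' p) \<noteq> orb z"
      using that X h h' orb_H[OF h] by (metis H_closed)+
    then show ?thesis
      using that c(5) h' l k by simp
  qed
  then have "cyc l (h x) (h y) (h z)"
    unfolding cyc_def using X h h' c l k by simp
  then show ?thesis
    using T h X l(1) unfolding T_def by (auto simp: orb_H)
qed

text \<open>The supports of \<open>f\<close> and \<open>g\<close> meet in a single orbit, so the
  commutator f g f^-1 g^-1 acts as a 3-cycle on it and its images. Since \<open>f x\<close> and
  \<open>g x\<close> leave the orbit of \<open>x\<close>, each is fixed by the other map, and the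
  same holds for the preimages of \<open>x\<close>.\<close>

lemma T_commutator:
  assumes f: "f \<in> H" and g: "g \<in> H" and x: "x \<in> X"
    and supp: "\<And>p. p \<in> X \<Longrightarrow> f p \<noteq> p \<Longrightarrow> g p \<noteq> p \<Longrightarrow> orb p = orb x"
    and fx: "orb (f x) \<noteq> orb x" and gx: "orb (g x) \<noteq> orb x"
  shows "T x (f x) (g x)"
proof -
  obtain f' where f': "f' \<in> H" "\<And>x. x \<in> X \<Longrightarrow> f' (f x) = x" "\<And>x. x \<in> X \<Longrightarrow> f (f' x) = x"
    using H_obtain_inv[OF f] by metis
  obtain g' where g': "g' \<in> H" "\<And>x. x \<in> X \<Longrightarrow> g' (g x) = x" "\<And>x. x \<in> X \<Longrightarrow> g (g' x) = x"
    using H_obtain_inv[OF g] by metis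
  obtain k where k: "k \<in> H" "\<And>x. x \<in> X \<Longrightarrow> k x = f' (g' x)"
    using H_obtain_comp[OF f'(1) g'(1)] by metis
  obtain l where l: "l \<in> H" "\<And>x. x \<in> X \<Longrightarrow> l x = g (k x)"
    using H_obtain_comp[OF g k(1)] by metis
  obtain c where c: "c \<in> H" "\<And>x. x \<in> X \<Longrightarrow> c x = f (l x)"
    using H_obtain_comp[OF f l(1)] by metis
  note cl = H_closed[OF f] H_closed[OF g] H_closed[OF f'(1)] H_closed[OF g'(1)]
  have cc: "c p = f (g (f' (g' p)))" if "p \<in> X" for p
    using that c l k by simp
  have mf: "f (f p) \<noteq> f p" "f' p \<noteq> p" "f (f' p) \<noteq> f' p" if "p \<in> X" "f p \<noteq> p" for p
    using that f' cl by metis+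
  have mg: "g (g p) \<noteq> g p" "g' p \<noteq> p" "g (g' p) \<noteq> g' p" if "p \<in> X" "g p \<noteq> p" for p
    using that g' cl by metis+
  have fx': "f x \<noteq> x" and gx': "g x \<noteq> x" 
    using fx gx by auto
  have gfx: "g (f x) = f x"
    using supp[of "f x"] mf(1)[OF x fx'] fx x cl by auto
  have fgx: "f (g x) = g x"
    using supp[of "g x"] mg(1)[OF x gx'] gx x cl by auto
  have f'_orb: "orb (f' x) \<noteq> orb x"
    using orb_H[OF f, of "f' x" x] f' x cl fx by auto
  have g'_orb: "orb (g' x) \<noteq> orb x"
    using orb_H[OF g, of "g' x" x] g' x cl gx by auto
  have gf'x: "g (f' x) = f' x"
    using supp[of "f' x"] mf(3)[OF x fx'] f'_orb x cl by auto
  have fg'x: "f (g' x) = g' x"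
    using supp[of "g' x"] mg(3)[OF x gx'] g'_orb x cl by auto
  have c1: "c x = f x"
    using cc[OF x] fg'x f' g' x cl by (metis)
  have c2: "c (f x) = g x"
    using cc[of "f x"] gfx fgx f' g' x cl by (metis)
  have c3: "c (g x) = x"
    using cc[of "g x"] gf'x f' g' x cl by (metis)
  \<comment> \<open>Otherwise \<open>g x\<close> would be a conjugate of \<open>f x\<close>, hence
    moved by \<open>f\<close>, against \<open>fgx\<close>.\<close>
  have no: "orb (f x) \<noteq> orb (g x)"
  proof
    assume "orb (f x) = orb (g x)"
    then obtain j where "g x = act j (f x)"
      using orb_eq_iff x cl by metis
    then have "g x = f (act j x)" using H_act f x by simp
    then have "f (g x) \<noteq> g x"
      using mf(1)[of "act j x"] x fx' by (metis act_closed H_act H_eq_iff f act_eq_iff cl(1))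
    then show False using fgx by simp
  qed
  have "c p = p" if p: "p \<in> X" "orb p \<noteq> orb x" "orb p \<noteq> orb (f x)" "orb p \<noteq> orb (g x)" for p
  proof (cases "g p = p")
    case True
    then have gp: "g' p = p" using g' p by metis
    have w: "f' p \<in> X" using cl p by blast
    show ?thesis
    proof (cases "f p = p")
      case True
      then show ?thesis using cc p gp \<open>g p = p\<close> f' by metis
    next
      case False
      have "g (f' p) = f' p"
      proof (rule ccontr)
        assume "g (f' p) \<noteq> f' p"
        then have "orb (f' p) = orb x"
          using supp[OF w] mf(3)[OF p(1) False] by auto
        then have "orb (f (f' p)) = orb (f x)"
          using orb_H[OF f w x] by simp
        then show False using f' p by simp
      qed
      then show ?thesis using cc p gp f' by simp
    qed
  next
    case False
    then have fp: "f p = p" using supp p by blast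
    have w: "g' p \<in> X" using cl p by blast
    have "f (g' p) = g' p"
    proof (rule ccontr)
      assume "f (g' p) \<noteq> g' p"
      then have "orb (g' p) = orb x"
        using supp[OF w] mg(3)[OF p(1) False] by auto
      then have "orb (g (g' p)) = orb (g x)"
        using orb_H[OF g w x] by simp
      then show False using g' p by simp
    qed
    then have "f' (g' p) = g' p" using f' w by metis
    then show ?thesis using cc p g' fp by simp
  qed
  then have "cyc c x (f x) (g x)"
    unfolding cyc_def using c1 c2 c3 by blast
  then show ?thesis
    unfolding T_def using c(1) x cl fx gx no by metis
qed

end

section \<open>Spreading 3-cycles from a seed\<close>

context equivariant_perms begin

text \<open>The 3-cycle on \<open>a, b, y\<close> fixes \<open>x\<close>; conjugating the 3-cycle on
  \<open>a, b, x\<close> by it once and twice replaces the pair \<open>a, b\<close> by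
  \<open>b, y\<close> and by \<open>y, a\<close>.\<close>

lemma T_exchange:
  assumes "T a b x" "T a b y" "orb x \<noteq> orb y"
  shows "T a x y" "T b x y"
proof -
  obtain c where c: "c \<in> H" "c a = b" "c b = y" "c y = a"
    "\<And>p. p \<in> X \<Longrightarrow> orb p \<noteq> orb a \<Longrightarrow> orb p \<noteq> orb b \<Longrightarrow> orb p \<noteq> orb y \<Longrightarrow> c p = p"
    using T_obtain[OF assms(2)] by metis
  have cx: "c x = x"
    using c(5) assms T_X T_orb by metis
  have 1: "T b y x"
    using T_H[OF c(1) assms(1)] c cx by simp
  have 2: "T y a x"
    using T_H[OF c(1) 1] c cx by simp
  show "T a x y" "T b x y"
    using T_perms[OF 1] T_perms[OF 2] by auto
qed

text \<open>If \<open>z\<close> avoids the orbits of \<open>a\<close> and \<open>b\<close>,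
  conjugating by the 3-cycle on \<open>x, w, z\<close> carries \<open>x\<close> to \<open>w\<close>
  and keeps \<open>a, b\<close>. If \<open>z\<close> collides with one of them, the 3-cycle on
  \<open>x, w, z\<close> is itself conjugated so that \<open>z\<close> moves into the orbit of the
  spare point \<open>x'\<close>.\<close>

lemma T_replace:
  assumes ab: "T a b x" and xw: "T x w z" and w: "orb w \<noteq> orb a" "orb w \<noteq> orb b"
    and x': "T a b x'" "orb x' \<noteq> orb x" "orb x' \<noteq> orb w"
  shows "T a b w"
proof -
  have *: "T a b w" if xw: "T x w z" and z: "orb z \<noteq> orb a" "orb z \<noteq> orb b" for z
  proof -
    obtain c where c: "c \<in> H" "c x = w"
      "\<And>p. p \<in> X \<Longrightarrow> orb p \<noteq> orb x \<Longrightarrow> orb p \<noteq> orb w \<Longrightarrow> orb p \<noteq> orb z \<Longrightarrow> c p = p"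
      using T_obtain[OF xw] by metis
    have "c a = a" "c b = b"
      using c(3) T_X[OF ab] T_orb[OF ab] w z by metis+
    then show ?thesis
      using T_H[OF c(1) ab] c by simp
  qed
  have **: "T a b w" if c: "c \<in> H" "orb (c z) = orb x'"
      "\<And>p. p \<in> X \<Longrightarrow> orb p \<noteq> orb a \<Longrightarrow> orb p \<noteq> orb b \<Longrightarrow> orb p \<noteq> orb x' \<Longrightarrow> c p = p" for c
  proof -
    have "c x = x" "c w = w"
      using c(3) T_X[OF xw] T_orb[OF ab] w x' by metis+
    then have "T x w (c z)"
      using T_H[OF c(1) xw] by simp
    then show ?thesis
      using *[of "c z"] c(2) T_orb[OF x'(1)] by simp
  qed
  have a: "a \<in> X" and b: "b \<in> X" and z: "z \<in> X"
    using T_X ab xw by blast+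
  consider "orb z = orb a" | "orb z = orb b" | "orb z \<noteq> orb a" "orb z \<noteq> orb b" by blast
  then show ?thesis
  proof cases
    case 1
    obtain c where c: "c \<in> H" "c a = x'"
      "\<And>p. p \<in> X \<Longrightarrow> orb p \<noteq> orb a \<Longrightarrow> orb p \<noteq> orb x' \<Longrightarrow> orb p \<noteq> orb b \<Longrightarrow> c p = p"
      using T_obtain[OF T_rev[OF x'(1)]] by metis
    show ?thesis
      using ** c orb_H[OF c(1) z a] 1 by metis
  next
    case 2
    obtain c where c: "c \<in> H" "c b = x'"
      "\<And>p. p \<in> X \<Longrightarrow> orb p \<noteq> orb a \<Longrightarrow> orb p \<noteq> orb b \<Longrightarrow> orb p \<noteq> orb x' \<Longrightarrow> c p = p"
      using T_obtain[OF x'(1)] by metis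
    show ?thesis
      using ** c orb_H[OF c(1) z b] 2 by metis
  next
    case 3
    then show ?thesis using * xw by blast
  qed
qed

text \<open>The 3-cycle sending \<open>a\<close> to \<open>x'\<close> fixes \<open>w\<close> and
  turns a cycle starting at \<open>a\<close> into one starting at \<open>x'\<close>. This reduces to
  \<open>T_replace\<close>, with \<open>x''\<close> as the spare point.\<close>

lemma T_replace_base:
  assumes aw: "T a w z" and w: "orb w \<noteq> orb b"
    and x': "T a b x'" "orb x' \<noteq> orb w"
    and x'': "T a b x''" "orb x'' \<noteq> orb x'" "orb x'' \<noteq> orb w"
  shows "T a b w"
proof -
  obtain c where c: "c \<in> H" "c a = x'"
    "\<And>p. p \<in> X \<Longrightarrow> orb p \<noteq> orb a \<Longrightarrow> orb p \<noteq> orb x' \<Longrightarrow> orb p \<noteq> orb b \<Longrightarrow> c p = p"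
    using T_obtain[OF T_rev[OF x'(1)]] by metis
  have "c w = w"
    using c(3) T_X[OF aw] T_orb[OF aw] w x' by metis
  then have "T x' w (c z)"
    using T_H[OF c(1) aw] c by simp
  from T_replace[OF x'(1) this _ w x''] show ?thesis
    using T_orb[OF aw] by blast
qed

text \<open>If both \<open>x\<close> and its Frobenius twist complete the pair \<open>a, b\<close>, then the quotient of the two
  3-cycles twists \<open>b\<close> against \<open>x\<close>; conjugating with it transports the twist to other points.\<close>

lemma T_twist_base:
  assumes x: "T a b x" "T a b (act i x)" and y: "T a b y" "orb y \<noteq> orb x"
  shows "T y a (act i b)"
proof -
  have X: "a \<in> X" "b \<in> X" "x \<in> X" "y \<in> X" using T_X x y by blast+
  obtain c where c: "c \<in> H" "c a = b" "c b = act i x" "c (act i x) = a"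
    "\<And>p. p \<in> X \<Longrightarrow> orb p \<noteq> orb a \<Longrightarrow> orb p \<noteq> orb b \<Longrightarrow> orb p \<noteq> orb x \<Longrightarrow> c p = p"
    using T_obtain[OF x(2)] X by (metis orb_act)
  obtain c' where c': "c' \<in> H" "c' a = x" "c' x = b" "c' b = a"
    "\<And>p. p \<in> X \<Longrightarrow> orb p \<noteq> orb a \<Longrightarrow> orb p \<noteq> orb x \<Longrightarrow> orb p \<noteq> orb b \<Longrightarrow> c' p = p"
    using T_obtain[OF T_rev[OF x(1)]] by metis
  have "c y = y" "c' y = y"
    using c(5) c'(5) X T_orb[OF y(1)] y(2) by metis+
  moreover have "c' (act i x) = act i b"
    using H_act[OF c'(1) X(3)] c'(3) by simp
  moreover have "T y a b" using T_perms[OF y(1)] by blast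
  ultimately show ?thesis
    using T_H[OF c'(1) T_H[OF c(1), of y a b]] c c' by simp
qed

text \<open>The 3-cycle b -> y -> a -> b transports the twist from \<open>b\<close> to
  \<open>y\<close>: it sends \<open>y, a, act i b\<close> to \<open>a, b, act i y\<close>.\<close>

lemma T_twist:
  assumes x: "T a b x" "T a b (act i x)" and y: "T a b y" "orb y \<noteq> orb x"
  shows "T a b (act i y)"
proof -
  have "T b y a" using T_rot[OF y(1)] .
  then obtain g where g: "g \<in> H" "g b = y" "g y = a" "g a = b"
    using T_obtain by metis
  have "g (act i b) = act i y"
    using H_act[OF g(1)] g(2) T_X[OF y(1)] by simp
  then show ?thesis
    using T_H[OF g(1) T_twist_base[OF x y]] g by simp
qed

text \<open>The product of the two 3-cycles fixes the orbit of \<open>x\<close>. It undoes the twist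
  by \<open>i\<close> on the orbit of \<open>b\<close> and in exchange twists the orbit of
  \<open>a\<close> by \<open>i\<close>. This is why the image of \<open>b\<close> can be normalised
  completely while that of \<open>a\<close> stays free.\<close>

lemma rotation:
  assumes x: "T x a b" "T x a (act i b)"
  obtains k where "k \<in> H" "k (act i b) = b"
    "\<And>p. p \<in> X \<Longrightarrow> orb p \<noteq> orb a \<Longrightarrow> orb p \<noteq> orb b \<Longrightarrow> k p = p"
proof -
  have X: "a \<in> X" "b \<in> X" "x \<in> X" using T_X x by blast+
  obtain c where c: "c \<in> H" "c x = b" "c b = a" "c a = x"
    "\<And>p. p \<in> X \<Longrightarrow> orb p \<noteq> orb x \<Longrightarrow> orb p \<noteq> orb b \<Longrightarrow> orb p \<noteq> orb a \<Longrightarrow> c p = p"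
    using T_obtain[OF T_rev[OF x(1)]] by metis
  obtain c' where c': "c' \<in> H" "c' x = a" "c' a = act i b" "c' (act i b) = x"
    "\<And>p. p \<in> X \<Longrightarrow> orb p \<noteq> orb x \<Longrightarrow> orb p \<noteq> orb a \<Longrightarrow> orb p \<noteq> orb b \<Longrightarrow> c' p = p"
    using T_obtain[OF x(2)] X by (metis orb_act)
  obtain k where k: "k \<in> H" "\<And>p. p \<in> X \<Longrightarrow> k p = c (c' p)"
    using H_obtain_comp[OF c(1) c'(1)] by metis
  have "k (act i b) = b"
    using k c c' X by simp
  moreover have "k p = p" if p: "p \<in> X" "orb p \<noteq> orb a" "orb p \<noteq> orb b" for p
  proof (cases "orb p = orb x")
    case True
    then obtain j where "p = act j x" using orb_eq_iff p X by metis
    moreover have "c (c' x) = x" using c c' by simp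
    ultimately show ?thesis
      using k(2) H_act[OF c(1)] H_act[OF c'(1)] X H_closed[OF c'(1)] by simp
  next
    case False
    then show ?thesis using k c(5) c'(5) p by simp
  qed
  ultimately show ?thesis using that k(1) by blast
qed

end

text \<open>Three completions of the pair \<open>a, b\<close> in distinct orbits leave one outside
  any two prescribed orbits, which supplies the spare points for collisions.\<close>

locale seeded_perms = equivariant_perms +
  fixes a b x1 x2 x3
  assumes seed: "T a b x1" "T a b x2" "T a b x3"
    and seed_orb: "orb x1 \<noteq> orb x2" "orb x1 \<noteq> orb x3" "orb x2 \<noteq> orb x3"
begin

lemma seed_avoiding:
  obtains x where "T a b x" "orb x \<noteq> orb v" "orb x \<noteq> orb w"
  using seed seed_orb by metis

text \<open>The points completing \<open>a, b\<close> spread along every 3-cycle that starts at a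
  point already reached, whatever its third point is. The case \<open>s = b\<close> is the case
  \<open>s = a\<close> with the two base points exchanged.\<close>

lemma T_closed:
  assumes s: "s = a \<or> s = b \<or> T a b s" and sw: "T s w z"
    and w: "orb w \<noteq> orb a" "orb w \<noteq> orb b"
  shows "T a b w"
proof -
  obtain x' where x': "T a b x'" "orb x' \<noteq> orb s" "orb x' \<noteq> orb w"
    using seed_avoiding by metis
  obtain x'' where x'': "T a b x''" "orb x'' \<noteq> orb x'" "orb x'' \<noteq> orb w"
    using seed_avoiding by metis
  from s consider "s = a" | "s = b" | "T a b s" by blast
  then show ?thesis
  proof cases
    case 1
    then have "T a w z" using sw by simp
    from T_replace_base[OF this w(2) x'(1,3) x''] show ?thesis .
  next
    case 2
    then have "T b w z" using sw by simp
    from T_replace_base[OF this w(1) _ x'(3) _ x''(2,3)] have "T b a w"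
      using T_perms[OF x'(1)] T_perms[OF x''(1)] by blast
    from T_perms[OF this] show ?thesis by blast
  next
    case 3
    from T_replace[OF this sw w x'] show ?thesis .
  qed
qed

text \<open>\<open>T_twist\<close> transports a twist only to a different orbit. The twist of
  \<open>x2\<close> therefore passes to \<open>x1\<close> first; after that every \<open>y\<close>
  differs in orbit from one of these two.\<close>

lemma T_act_closed:
  assumes tw: "T a b (act 1 x2)" and y: "T a b y"
  shows "T a b (act j y)"
proof -
  have x1: "T a b (act 1 x1)"
    using T_twist[OF seed(2) tw seed(1)] seed_orb by blast
  have 1: "T a b (act 1 y)" if "T a b y" for y
    using T_twist[OF seed(1) x1 that] T_twist[OF seed(2) tw that] seed_orb by metis
  have "y \<in> X" using T_X y by blast
  show ?thesis
  proof (induction j)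
    case (Suc j)
    then show ?case using 1[OF Suc.IH] act_add[OF \<open>y \<in> X\<close>, of 1 j] by simp
  qed (use y \<open>y \<in> X\<close> in simp)
qed

text \<open>The orbits of \<open>a\<close> and \<open>b\<close> are included because a point moved
  by elements of \<open>H\<close> may pass through them, where \<open>T a b\<close> cannot
  hold.\<close>

definition linked :: "'a \<Rightarrow> bool" where
  "linked x \<longleftrightarrow> orb x = orb a \<or> orb x = orb b \<or> T a b x"

text \<open>A point \<open>s\<close> of the seed that \<open>h\<close> fixes lies on a 3-cycle with
  \<open>x\<close>; its image under \<open>h\<close> is a 3-cycle through \<open>s\<close> and
  \<open>h x\<close>, and \<open>T_closed\<close> applies. If \<open>x\<close> is only a conjugate
  of \<open>a\<close> or \<open>b\<close>, the argument is made for that base point and the result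
  is twisted back.\<close>

lemma linked_step:
  assumes tw: "T a b (act 1 x2)" and x: "x \<in> X" "linked x" and h: "h \<in> H"
    and s: "s = a \<or> s = b \<or> s = x1" "h s = s" "orb s \<noteq> orb x"
  shows "linked (h x)"
proof -
  have X: "a \<in> X" "b \<in> X" "x1 \<in> X" using T_X seed by blast+
  have 1: "linked (h x)" if x: "x = a \<or> x = b \<or> T a b x" and sx: "orb s \<noteq> orb x" for x
  proof -
    have "\<exists>t. T x s t"
      using s(1) x sx seed(1) T_perms[OF seed(1)] T_perms T_exchange[of a b x1 x] by metis
    then obtain t where "T s (h x) (h t)"
      using T_H[OF h] s(2) T_perms by metis
    moreover have "s = a \<or> s = b \<or> T a b s"
      using s(1) seed(1) by auto
    ultimately show ?thesis
      unfolding linked_def using T_closed by metis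
  qed
  have 2: "linked (h x)" if v: "v = a \<or> v = b" and vx: "orb x = orb v" for v
  proof -
    obtain j where j: "x = act j v"
      using vx v X x(1) orb_eq_iff by metis
    have hv: "h v \<in> X" "h x = act j (h v)"
      using v X H_closed[OF h] H_act[OF h] j by auto
    have "linked (h v)"
      using 1 v vx s(3) by metis
    then show ?thesis
      unfolding linked_def using hv T_act_closed[OF tw] by auto
  qed
  show ?thesis
    using x(2) 1 2 s(3) unfolding linked_def by metis
qed

end

section \<open>Coset representatives\<close>

text \<open>The set \<open>P\<close> behaves like a subgroup of the integers seen through its
  nonnegative part, and \<open>d\<close> is its least positive element. It yields both the degree of
  a point and the degree of a field element.\<close>

lemma period_exists:
  fixes P :: "nat \<Rightarrow> bool"
  assumes shift: "\<And>i j. P i \<Longrightarrow> P (i + j) \<longleftrightarrow> P j" and m: "P m" "m > 0"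
  obtains d where "d > 0" "\<And>j. P j \<longleftrightarrow> d dvd j"
proof -
  define d where "d = (LEAST j. P j \<and> j > 0)"
  have d: "P d" "d > 0"
    using LeastI[of "\<lambda>j. P j \<and> j > 0" m] m by (auto simp: d_def)
  have least: "\<not> P j" if "0 < j" "j < d" for j
    using not_less_Least[of j "\<lambda>j. P j \<and> j > 0"] that by (auto simp: d_def)
  have add: "P (k * d + j) \<longleftrightarrow> P j" for k j
  proof (induction k)
    case (Suc k)
    then show ?case using shift[OF d(1), of "k * d + j"] by (simp add: add.assoc)
  qed simp
  have 0: "P 0" using shift[OF d(1), of 0] d by simp
  have "P j \<longleftrightarrow> d dvd j" for j
    using add[of "j div d" "j mod d"] least[of "j mod d"] 0 d(2)
    by (cases "j mod d = 0") (auto simp: mod_eq_0_iff_dvd)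
  then show ?thesis using that d by blast
qed

context equivariant_perms begin

lemma H_id: "H \<noteq> {} \<Longrightarrow> \<exists>h\<in>H. \<forall>x\<in>X. h x = x"
  using H_comp H_inv by (metis equals0I)

text \<open>These are the points of degree \<open>d\<close>, described by their stabiliser instead
  of by the size of their orbit.\<close>

definition pts :: "nat \<Rightarrow> 'p set" where
  "pts d = {x \<in> X. \<forall>j. act j x = x \<longleftrightarrow> d dvd j}"

definition equivariant :: "('p \<Rightarrow> 'p) \<Rightarrow> bool" where
  "equivariant g \<longleftrightarrow> (\<forall>x\<in>X. g x \<in> X \<and> (\<forall>j. g (act j x) = act j (g x))) \<and> inj_on g X"

lemma pts_X: "x \<in> pts d \<Longrightarrow> x \<in> X"
  by (simp add: pts_def)

lemma equivariant_H: "h \<in> H \<Longrightarrow> equivariant h"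
  unfolding equivariant_def inj_on_def using H_closed H_act H_eq_iff by metis

lemma equivariant_comp:
  assumes "equivariant f" "equivariant g" shows "equivariant (\<lambda>x. f (g x))"
  using assms unfolding equivariant_def inj_on_def by metis

lemma pts_equivariant:
  assumes g: "equivariant g" and x: "x \<in> pts d" shows "g x \<in> pts d"
proof -
  have X: "x \<in> X" "g x \<in> X" using x g by (auto simp: pts_def equivariant_def)
  have "act j (g x) = g x \<longleftrightarrow> act j x = x" for j
    using g X act_closed unfolding equivariant_def inj_on_def by metis
  then show ?thesis using x X by (simp add: pts_def)
qed

lemma pts_act: "x \<in> pts d \<Longrightarrow> act j x \<in> pts d"
  by (rule pts_equivariant[of "act j"])
     (auto simp: equivariant_def inj_on_def act_eq_iff simp flip: act_add intro: arg_cong[of _ _ "\<lambda>i. act i _"])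

lemma pts_orb:
  assumes "x \<in> pts d" "y \<in> X" "orb y = orb x" shows "y \<in> pts d"
  using assms pts_act pts_X orb_eq_iff by metis

lemma pts_exists:
  assumes x: "x \<in> X" obtains d where "d dvd m" "x \<in> pts d"
proof -
  have "act (i + j) x = x \<longleftrightarrow> act j x = x" if "act i x = x" for i j
  proof -
    have "act (i + j) x = act j (act i x)" using act_add[OF x, of j i] by (simp add: add.commute)
    then show ?thesis using that by simp
  qed
  from period_exists[of "\<lambda>j. act j x = x", OF this act_m[OF x] m_pos] obtain d
    where d: "\<And>j. act j x = x \<longleftrightarrow> d dvd j" by metis
  then have "d dvd m" using act_m[OF x] by blast
  then show ?thesis using that d x by (auto simp: pts_def)
qed

lemma pts_unique: "x \<in> pts d \<Longrightarrow> x \<in> pts e \<Longrightarrow> d = e"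
  unfolding pts_def by (simp add: dvd_antisym) (metis dvd_antisym dvd_refl)

lemma card_orb_le:
  assumes x: "x \<in> pts d" and d: "d > 0" shows "finite (orb x)" "card (orb x) \<le> d"
proof -
  have X: "x \<in> X" using x by (rule pts_X)
  have "orb x \<subseteq> (\<lambda>j. act j x) ` {..<d}"
  proof
    fix y assume "y \<in> orb x"
    then obtain j where j: "y = act j x" by (auto simp: orb_def)
    have "act (d * (j div d)) x = x" using x by (simp add: pts_def)
    then have "y = act (j mod d) x"
      unfolding j using act_add[OF X, of "j mod d" "d * (j div d)"] by simp
    then show "y \<in> (\<lambda>j. act j x) ` {..<d}" using d by simp
  qed
  moreover have "card ((\<lambda>j. act j x) ` {..<d}) \<le> d"
    using card_image_le[of "{..<d}" "\<lambda>j. act j x"] by simp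
  ultimately show "finite (orb x)" "card (orb x) \<le> d"
    using finite_subset[of "orb x" "(\<lambda>j. act j x) ` {..<d}"]
      card_mono[of "(\<lambda>j. act j x) ` {..<d}" "orb x"] by auto
qed

definition reduced :: "'p \<Rightarrow> 'p \<Rightarrow> nat \<Rightarrow> ('p \<Rightarrow> 'p) \<Rightarrow> bool" where
  "reduced a b d g \<longleftrightarrow>
     (\<forall>p\<in>pts d. orb p \<noteq> orb a \<longrightarrow> orb p \<noteq> orb b \<longrightarrow> g p = p) \<and> (g b = a \<or> g b = b)"

text \<open>Induction on the number of moved points outside the two orbits. A moved point
  \<open>x\<close> is repaired by some \<open>k\<close> sending \<open>g x\<close> back to
  \<open>x\<close> and supported on the orbits of \<open>a\<close>, \<open>b\<close>,
  \<open>x\<close> and \<open>g x\<close>. No fixed point outside the first two orbits is disturbed: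
  by equivariance and injectivity the orbits of \<open>x\<close> and \<open>g x\<close> contain no
  fixed point of \<open>g\<close>.\<close>

lemma reduce_outside:
  assumes fin: "finite X" and ne: "H \<noteq> {}" and ab: "a \<in> pts d" "b \<in> pts d"
    and all: "\<And>w. w \<in> pts d \<Longrightarrow> orb w \<noteq> orb a \<Longrightarrow> orb w \<noteq> orb b \<Longrightarrow> T a b w"
    and g: "equivariant g"
  shows "\<exists>h\<in>H. (\<forall>p\<in>X - pts d. h p = p) \<and>
    (\<forall>p\<in>pts d. orb p \<noteq> orb a \<longrightarrow> orb p \<noteq> orb b \<longrightarrow> h (g p) = p)"
  using g
proof (induction "card {p \<in> pts d. orb p \<noteq> orb a \<and> orb p \<noteq> orb b \<and> g p \<noteq> p}"
    arbitrary: g rule: less_induct)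
  case less
  let ?mv = "\<lambda>g. {p \<in> pts d. orb p \<noteq> orb a \<and> orb p \<noteq> orb b \<and> g p \<noteq> p}"
  note X = pts_X[OF ab(1)] pts_X[OF ab(2)]
  show ?case
  proof (cases "?mv g = {}")
    case True
    then have "g p = p" if "p \<in> pts d" "orb p \<noteq> orb a" "orb p \<noteq> orb b" for p
      using that by blast
    moreover obtain h where "h \<in> H" "\<And>x. x \<in> X \<Longrightarrow> h x = x"
      using H_id[OF ne] by blast
    ultimately show ?thesis using pts_X by (intro bexI[of _ h]) auto
  next
    case False
    then obtain x where x: "x \<in> pts d" "orb x \<noteq> orb a" "orb x \<noteq> orb b" "g x \<noteq> x" by blast
    define y where "y = g x"
    have y: "y \<in> pts d" using pts_equivariant[OF less.prems x(1)] by (simp add: y_def)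
    note XX = X pts_X[OF x(1)] pts_X[OF y]
    have Tx: "T a b x" using all x by blast
    have "\<exists>k\<in>H. k y = x \<and> (\<forall>p\<in>X. orb p \<noteq> orb a \<longrightarrow> orb p \<noteq> orb b \<longrightarrow> orb p \<noteq> orb x \<longrightarrow> orb p \<noteq> orb y \<longrightarrow> k p = p)"
    \<comment> \<open>If \<open>y\<close> is a conjugate of \<open>a\<close> or \<open>b\<close>,
      one 3-cycle suffices, aimed at the conjugate of \<open>x\<close> that compensates for
      \<open>y = act j v\<close>. Otherwise two are composed, sending \<open>y\<close> to
      \<open>a\<close> and then \<open>a\<close> to \<open>x\<close>.\<close>
    proof (cases "orb y = orb a \<or> orb y = orb b")
      case True
      then obtain v u where v: "orb y = orb v" "v = a \<and> u = b \<or> v = b \<and> u = a" by blast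
      then have Xv: "v \<in> X" using X by auto
      obtain j where j: "y = act j v" using v XX Xv orb_eq_iff by metis
      obtain i where i: "act j (act i x) = x" using act_inverse[of j] XX by metis
      have "T a b (act i x)" using all pts_act x XX by simp
      then have "T v (act i x) u" using v(2) T_perms by metis
      then obtain c where c: "c \<in> H" "c v = act i x"
        "\<And>p. p \<in> X \<Longrightarrow> orb p \<noteq> orb v \<Longrightarrow> orb p \<noteq> orb (act i x) \<Longrightarrow> orb p \<noteq> orb u \<Longrightarrow> c p = p"
        using T_obtain by metis
      have "c y = x" using H_act[OF c(1) Xv] j c(2) i by simp
      moreover have "orb (act i x) = orb x" using XX by simp
      ultimately show ?thesis using c v(2) by metis
    next
      case False
      then have Ty: "T a b y" using all y by blast
      obtain c where c: "c \<in> H" "c y = a"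
        "\<And>p. p \<in> X \<Longrightarrow> orb p \<noteq> orb a \<Longrightarrow> orb p \<noteq> orb b \<Longrightarrow> orb p \<noteq> orb y \<Longrightarrow> c p = p"
        using T_obtain[OF Ty] by metis
      obtain c' where c': "c' \<in> H" "c' a = x"
        "\<And>p. p \<in> X \<Longrightarrow> orb p \<noteq> orb a \<Longrightarrow> orb p \<noteq> orb x \<Longrightarrow> orb p \<noteq> orb b \<Longrightarrow> c' p = p"
        using T_obtain[OF T_rev[OF Tx]] by metis
      obtain k where k: "k \<in> H" "\<And>p. p \<in> X \<Longrightarrow> k p = c' (c p)"
        using H_obtain_comp[OF c'(1) c(1)] by metis
      have "k y = x" using k XX c c' by simp
      then show ?thesis using k c(3) c'(3) by (intro bexI[of _ k]) auto
    qed
    then obtain k where k: "k \<in> H" "k y = x"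
      "\<And>p. p \<in> X \<Longrightarrow> orb p \<noteq> orb a \<Longrightarrow> orb p \<noteq> orb b \<Longrightarrow> orb p \<noteq> orb x \<Longrightarrow> orb p \<noteq> orb y \<Longrightarrow> k p = p"
      by blast
    have kg: "equivariant (\<lambda>p. k (g p))" using equivariant_comp equivariant_H k(1) less.prems by blast
    have g_inj: "g p = g p' \<longleftrightarrow> p = p'" if "p \<in> X" "p' \<in> X" for p p'
      using less.prems that unfolding equivariant_def inj_on_def by metis
    have g_act: "g (act j p) = act j (g p)" if "p \<in> X" for p j
      using less.prems that unfolding equivariant_def by metis
    have "k (g p) = p" if p: "p \<in> pts d" "orb p \<noteq> orb a" "orb p \<noteq> orb b" "g p = p" for p
    proof -
      have pX: "p \<in> X" using p by (simp add: pts_def)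
      have "orb p \<noteq> orb x"
      proof
        assume "orb p = orb x"
        then obtain j where j: "p = act j x" using orb_eq_iff XX pX by metis
        then have "act j (g x) = act j x" using g_act XX p by metis
        then show False using act_eq_iff XX x(4) y_def by metis
      qed
      moreover have "orb p \<noteq> orb y"
      proof
        assume "orb p = orb y"
        then obtain j where j: "y = act j p" using orb_eq_iff XX pX by metis
        then have "g y = y" using g_act pX p by metis
        then have "y = x" using g_inj XX y_def by metis
        then show False using x y_def by simp
      qed
      ultimately show ?thesis using k p pX by simp
    qed
    then have "?mv (\<lambda>p. k (g p)) \<subseteq> ?mv g" by blast
    moreover have "x \<in> ?mv g" "x \<notin> ?mv (\<lambda>p. k (g p))" using x k y_def by auto
    ultimately have "?mv (\<lambda>p. k (g p)) \<subset> ?mv g" by blast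
    moreover have "finite (?mv g)" using fin by (simp add: pts_def)
    ultimately have "card (?mv (\<lambda>p. k (g p))) < card (?mv g)" by (rule psubset_card_mono[rotated])
    from less.hyps[OF this kg] obtain h where h: "h \<in> H" "\<And>p. p \<in> X - pts d \<Longrightarrow> h p = p"
      "\<And>p. p \<in> pts d \<Longrightarrow> orb p \<noteq> orb a \<Longrightarrow> orb p \<noteq> orb b \<Longrightarrow> h (k (g p)) = p" by auto
    obtain l where l: "l \<in> H" "\<And>p. p \<in> X \<Longrightarrow> l p = h (k p)"
      using H_obtain_comp[OF h(1) k(1)] by metis
    have "k p = p" if "p \<in> X - pts d" for p
      using k(3)[of p] that pts_orb ab x(1) y by blast
    then have "l p = p" if "p \<in> X - pts d" for p using that l h by simp
    moreover have "g p \<in> X" if "p \<in> pts d" for p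
      using that pts_equivariant[OF less.prems] pts_X by blast
    ultimately show ?thesis using l h(3) by (intro bexI[of _ l]) auto
  qed
qed


text \<open>Once all other orbits of degree \<open>d\<close> are fixed pointwise, injectivity forces
  the image of \<open>b\<close> into the orbit of \<open>a\<close> or \<open>b\<close>. It is then a
  conjugate of \<open>a\<close> or \<open>b\<close>, and \<open>rotation\<close> removes the
  conjugation.\<close>

lemma reduce:
  assumes fin: "finite X" and ab: "a \<in> pts d" "b \<in> pts d"
    and all: "\<And>w. w \<in> pts d \<Longrightarrow> orb w \<noteq> orb a \<Longrightarrow> orb w \<noteq> orb b \<Longrightarrow> T a b w"
    and xy: "x \<in> pts d" "T a b x" "T a b y'" "orb y' \<noteq> orb x"
    and g: "equivariant g"
  shows "\<exists>h\<in>H. (\<forall>p\<in>X - pts d. h p = p) \<and> reduced a b d (\<lambda>p. h (g p))"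
proof -
  have ne: "H \<noteq> {}" using xy(2) by (auto simp: T_def)
  obtain h where h: "h \<in> H" "\<And>p. p \<in> X - pts d \<Longrightarrow> h p = p"
    "\<And>p. p \<in> pts d \<Longrightarrow> orb p \<noteq> orb a \<Longrightarrow> orb p \<noteq> orb b \<Longrightarrow> h (g p) = p"
    using reduce_outside[OF fin ne ab all g] by auto
  have hg: "equivariant (\<lambda>p. h (g p))" using equivariant_comp equivariant_H h(1) g by blast
  define y where "y = h (g b)"
  have yd: "y \<in> pts d" using pts_equivariant[OF hg ab(2)] by (simp add: y_def)
  note X = pts_X[OF ab(1)] pts_X[OF ab(2)] pts_X[OF yd] pts_X[OF xy(1)]
  have "orb y = orb a \<or> orb y = orb b"
  proof (rule ccontr)
    assume *: "\<not> ?thesis"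
    then have "h (g y) = y" using h(3) yd by blast
    then have "y = b" using hg X unfolding equivariant_def inj_on_def y_def by metis
    then show False using * by blast
  qed
  then obtain v u where v: "orb y = orb v" "v = a \<and> u = b \<or> v = b \<and> u = a" by blast
  then have Xv: "v \<in> X" using X by auto
  obtain i where i: "y = act i v" using v X Xv orb_eq_iff by metis
  have "T a b (act i x)"
    using all[of "act i x"] pts_act[OF xy(1)] X T_orb[OF xy(2)] by simp
  then have T: "T u v x" "T u v (act i x)" "T u v y'"
    using v(2) xy(2,3) T_perms by metis+
  \<comment> \<open>Here \<open>u, v\<close> play the roles of \<open>a, b\<close>. The 3-cycles on
    \<open>y', u, v\<close> and on \<open>y', u, act i v\<close> are the input of
    \<open>rotation\<close>, which brings \<open>act i v\<close> back to \<open>v\<close>.\<close>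
  then have "T y' u (act i v)"
    using T_twist_base xy(4) by metis
  moreover have "T y' u v" using T_perms[OF T(3)] by blast
  ultimately obtain k where k: "k \<in> H" "k (act i v) = v"
    "\<And>p. p \<in> X \<Longrightarrow> orb p \<noteq> orb u \<Longrightarrow> orb p \<noteq> orb v \<Longrightarrow> k p = p"
    using rotation by metis
  obtain l where l: "l \<in> H" "\<And>p. p \<in> X \<Longrightarrow> l p = k (h p)"
    using H_obtain_comp[OF k(1) h(1)] by metis
  have k': "k p = p" if "p \<in> X" "orb p \<noteq> orb a" "orb p \<noteq> orb b" for p
    using k(3) that v(2) by metis
  have gX: "g p \<in> X" if "p \<in> X" for p using g that by (simp add: equivariant_def)
  have "l p = p" if "p \<in> X - pts d" for p
    using that l(2)[of p] h(2)[OF that] k'[of p] pts_orb[OF ab(1), of p] pts_orb[OF ab(2), of p]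
    by fastforce
  moreover have "l (g p) = p" if "p \<in> pts d" "orb p \<noteq> orb a" "orb p \<noteq> orb b" for p
    using l(2)[OF gX] h(3) k' that pts_X by simp
  moreover have "l (g b) = v"
    using l(2)[OF gX] X k(2) i y_def by simp
  ultimately show ?thesis using l(1) v(2) unfolding reduced_def by (intro bexI[of _ l]) auto
qed

text \<open>The degrees do not interact: the correction made in degree \<open>e\<close> fixes all
  points of other degrees, so it preserves the normal form already reached there.\<close>

lemma reduce_all:
  assumes fin: "finite X" "finite D" and ne: "H \<noteq> {}"
    and ab: "\<And>d. d \<in> D \<Longrightarrow> a d \<in> pts d" "\<And>d. d \<in> D \<Longrightarrow> b d \<in> pts d"
    and all: "\<And>d w. d \<in> D \<Longrightarrow> w \<in> pts d \<Longrightarrow> orb w \<noteq> orb (a d) \<Longrightarrow> orb w \<noteq> orb (b d) \<Longrightarrow>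
      T (a d) (b d) w"
    and two: "\<And>d. d \<in> D \<Longrightarrow> \<exists>x y. x \<in> pts d \<and> T (a d) (b d) x \<and> T (a d) (b d) y \<and> orb x \<noteq> orb y"
    and g: "equivariant g"
  shows "\<exists>h\<in>H. \<forall>d\<in>D. reduced (a d) (b d) d (\<lambda>p. h (g p))"
  using fin(2) ab all two
proof (induction D)
  case empty
  then show ?case using ne by blast
next
  case (insert e D)
  then obtain h where h: "h \<in> H" "\<And>d. d \<in> D \<Longrightarrow> reduced (a d) (b d) d (\<lambda>p. h (g p))"
    by auto
  have hg: "equivariant (\<lambda>p. h (g p))" using equivariant_comp equivariant_H h(1) g by blast
  obtain x y where xy: "x \<in> pts e" "T (a e) (b e) x" "T (a e) (b e) y" "orb y \<noteq> orb x"
    using insert.prems(4)[of e] by auto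
  have "a e \<in> pts e" "b e \<in> pts e"
    "\<And>w. w \<in> pts e \<Longrightarrow> orb w \<noteq> orb (a e) \<Longrightarrow> orb w \<noteq> orb (b e) \<Longrightarrow> T (a e) (b e) w"
    using insert.prems(1-3) by blast+
  from reduce[OF fin(1) this xy hg] obtain k where k: "k \<in> H" "\<And>p. p \<in> X - pts e \<Longrightarrow> k p = p"
    "reduced (a e) (b e) e (\<lambda>p. k (h (g p)))" by auto
  obtain l where l: "l \<in> H" "\<And>p. p \<in> X \<Longrightarrow> l p = k (h p)"
    using H_obtain_comp[OF k(1) h(1)] by metis
  have gX: "g p \<in> X" if "p \<in> X" for p using g that by (simp add: equivariant_def)
  have "reduced (a d) (b d) d (\<lambda>p. l (g p))" if d: "d \<in> insert e D" for d
  proof -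
    have b: "b d \<in> pts d" using insert.prems(2) d by blast
    have lk: "l (g p) = k (h (g p))" if "p \<in> pts d" for p
      using that l(2) gX pts_X by blast
    show ?thesis
    proof (cases "d = e")
      case True
      then show ?thesis using k(3) lk b unfolding reduced_def by simp
    next
      case False
      have "h (g p) \<in> X - pts e" if "p \<in> pts d" for p
        using pts_equivariant[OF hg that] pts_unique False pts_X by blast
      then have "l (g p) = h (g p)" if "p \<in> pts d" for p
        using lk k(2) that by simp
      then show ?thesis using h(2)[of d] d False b unfolding reduced_def by simp
    qed
  qed
  then show ?case using l(1) by blast
qed

text \<open>A reduced map permutes the two exceptional orbits. The orbit of \<open>f a\<close>
  therefore decides which of them receives \<open>b\<close>, and there the image is exactly
  \<open>a\<close> or \<open>b\<close>; this makes \<open>f a\<close> the only free datum.\<close>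

lemma reduced_act:
  assumes f: "equivariant f" "reduced a b d f" and ab: "a \<in> pts d" "b \<in> pts d" "orb a \<noteq> orb b"
  shows "orb (f a) = orb a \<or> orb (f a) = orb b"
    and "f b = (if orb (f a) = orb a then b else a)"
proof -
  note X = pts_X[OF ab(1)] pts_X[OF ab(2)]
  have fa: "f a \<in> pts d" using pts_equivariant[OF f(1) ab(1)] .
  have fa_X: "f a \<in> X" using pts_X[OF fa] .
  show 1: "orb (f a) = orb a \<or> orb (f a) = orb b"
  proof (rule ccontr)
    assume *: "\<not> ?thesis"
    then have "f (f a) = f a" using f(2) fa by (simp add: reduced_def)
    then have "f a = a" using f(1) X fa_X unfolding equivariant_def inj_on_def by metis
    then show False using * by simp
  qed
  have ne: "orb (f a) \<noteq> orb (f b)"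
  proof
    assume "orb (f a) = orb (f b)"
    moreover have "f b \<in> X" using f(1) X by (simp add: equivariant_def)
    ultimately obtain j where "f b = act j (f a)" using orb_eq_iff fa_X by metis
    then have "f b = f (act j a)" using f(1) X by (simp add: equivariant_def)
    then have "b = act j a" using f(1) X unfolding equivariant_def inj_on_def by (metis act_closed)
    then show False using ab(3) X by simp
  qed
  show "f b = (if orb (f a) = orb a then b else a)"
    using f(2) ne 1 by (auto simp: reduced_def)
qed

lemma card_reduced_le:
  assumes D: "finite D" "X = (\<Union>d\<in>D. pts d)" "\<And>d. d \<in> D \<Longrightarrow> d > 0"
    and ab: "\<And>d. d \<in> D \<Longrightarrow> a d \<in> pts d" "\<And>d. d \<in> D \<Longrightarrow> b d \<in> pts d"
      "\<And>d. d \<in> D \<Longrightarrow> orb (a d) \<noteq> orb (b d)"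
  defines "R \<equiv> {f \<in> extensional X. equivariant f \<and> (\<forall>d\<in>D. reduced (a d) (b d) d f)}"
  shows "finite R \<and> card R \<le> (\<Prod>d\<in>D. 2 * d)"
proof -
  let ?F = "\<lambda>f. \<lambda>d\<in>D. f (a d)"
  let ?B = "\<lambda>d. orb (a d) \<union> orb (b d)"
  have fin: "finite (orb (a d))" "finite (orb (b d))" and card: "card (?B d) \<le> 2 * d"
    if "d \<in> D" for d
    using card_orb_le[OF ab(1)[OF that] D(3)[OF that]] card_orb_le[OF ab(2)[OF that] D(3)[OF that]]
      card_Un_le[of "orb (a d)" "orb (b d)"] by auto
  have orb_self: "x \<in> orb x" if "x \<in> X" for x
    using that act_0 unfolding orb_def by (metis rangeI)
  have "?F ` R \<subseteq> PiE D ?B"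
  proof (intro subsetI, elim imageE)
    fix h f assume hf: "h = ?F f" "f \<in> R"
    have "f (a d) \<in> ?B d" if d: "d \<in> D" for d
    proof -
      have "equivariant f" "reduced (a d) (b d) d f" using hf d by (auto simp: R_def)
      then show ?thesis
        using reduced_act(1)[of f "a d" "b d" d] ab d orb_self[of "f (a d)"] pts_equivariant[of f "a d" d] pts_X
        by blast
    qed
    then show "h \<in> PiE D ?B" using hf by auto
  qed
  moreover have inj: "inj_on ?F R"
  proof (rule inj_onI)
    fix f g assume f: "f \<in> R" and g: "g \<in> R" and fg: "?F f = ?F g"
    have "f x = g x" if x: "x \<in> X" for x
    proof -
      obtain d where d: "d \<in> D" "x \<in> pts d" using x D(2) by auto
      have ef: "equivariant f" "reduced (a d) (b d) d f" and eg: "equivariant g" "reduced (a d) (b d) d g"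
        using f g d by (auto simp: R_def)
      note X = pts_X[OF ab(1)[OF d(1)]] pts_X[OF ab(2)[OF d(1)]]
      have a: "f (a d) = g (a d)" using fun_cong[OF fg, of d] d(1) by simp
      have b: "f (b d) = g (b d)"
        using reduced_act(2)[OF ef ab[OF d(1)]] reduced_act(2)[OF eg ab[OF d(1)]] a by simp
      have act: "f (act j y) = g (act j y)" if "f y = g y" "y \<in> X" for j y
        using ef(1) eg(1) that by (simp add: equivariant_def)
      show ?thesis
      proof (cases "orb x = orb (a d) \<or> orb x = orb (b d)")
        case True
        then obtain j y where "x = act j y" "y = a d \<or> y = b d" 
          using orb_eq_iff[OF X(1) x] orb_eq_iff[OF X(2) x] by metis
        then show ?thesis using act a b X by metis
      next
        case False
        then show ?thesis using ef(2) eg(2) d(2) by (simp add: reduced_def)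
      qed
    qed
    then show "f = g" using f g by (intro extensionalityI[of f X g]) (auto simp: R_def)
  qed
  moreover have finB: "finite (PiE D ?B)" using D(1) fin by (intro finite_PiE) auto
  ultimately have "finite R" "card R \<le> card (PiE D ?B)"
    using card_inj_on_le[OF inj] finite_imageD finite_subset by blast+
  moreover have "card (PiE D ?B) \<le> (\<Prod>d\<in>D. 2 * d)"
    unfolding card_PiE[OF D(1)] using card by (intro prod_mono) auto
  ultimately show ?thesis by linarith
qed

end

section \<open>Evaluation of polynomials\<close>

definition ev :: "'a::comm_ring_1 mpoly \<Rightarrow> (nat \<Rightarrow> 'a) \<Rightarrow> 'a" where
  "ev p x = poly_eval id p x"

definition mon :: "(nat \<Rightarrow>\<^sub>0 nat) \<Rightarrow> (nat \<Rightarrow> 'a) \<Rightarrow> 'a::comm_ring_1" where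
  "mon k x = (\<Prod>i\<in>Poly_Mapping.keys k. x i ^ Poly_Mapping.lookup k i)"

lemma mon_superset:
  assumes "finite S" "Poly_Mapping.keys k \<subseteq> S"
  shows "mon k x = (\<Prod>i\<in>S. x i ^ Poly_Mapping.lookup k i)"
  unfolding mon_def using assms
  by (intro prod.mono_neutral_left) (auto simp: in_keys_iff)

lemma mon_add: "mon (k + l) x = mon k x * mon l x"
proof -
  let ?S = "Poly_Mapping.keys k \<union> Poly_Mapping.keys l"
  have "mon (k + l) x = (\<Prod>i\<in>?S. x i ^ Poly_Mapping.lookup (k + l) i)"
    using keys_add[of k l] by (intro mon_superset) auto
  then show ?thesis
    by (simp add: mon_superset[of ?S k] mon_superset[of ?S l] lookup_add power_add prod.distrib)
qed

text \<open>Allows two polynomials with different supports to be evaluated over one common index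
  set.\<close>

lemma poly_eval_superset:
  assumes "finite S" "Poly_Mapping.keys p \<subseteq> S" "phi 0 = 0"
  shows "poly_eval phi p x = (\<Sum>k\<in>S. phi (Poly_Mapping.lookup p k) * mon k x)"
  unfolding poly_eval_def mon_def[symmetric] using assms
  by (intro sum.mono_neutral_left) (auto simp: in_keys_iff)

lemma ev_superset:
  assumes "finite S" "Poly_Mapping.keys p \<subseteq> S"
  shows "ev p x = (\<Sum>k\<in>S. Poly_Mapping.lookup p k * mon k x)"
  unfolding ev_def using poly_eval_superset[OF assms, of id] by simp

lemma ev_zero [simp]: "ev 0 x = 0"
  by (simp add: ev_def poly_eval_def)

lemma ev_add [simp]: "ev (p + q) x = ev p x + ev q x"
proof -
  let ?S = "Poly_Mapping.keys p \<union> Poly_Mapping.keys q"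
  have "ev (p + q) x = (\<Sum>k\<in>?S. Poly_Mapping.lookup (p + q) k * mon k x)"
    using keys_add[of p q] by (intro ev_superset) auto
  then show ?thesis
    by (simp add: ev_superset[of ?S p] ev_superset[of ?S q] lookup_add
        sum.distrib distrib_right)
qed

lemma ev_sum [simp]: "ev (sum f A) x = (\<Sum>a\<in>A. ev (f a) x)"
  by (induction A rule: infinite_finite_induct) auto

lemma ev_single: "ev (Poly_Mapping.single k c) x = c * mon k x"
  by (subst ev_superset[of "{k}"]) auto

lemma poly_mapping_monomials:
  "p = (\<Sum>k\<in>Poly_Mapping.keys p. Poly_Mapping.single k (Poly_Mapping.lookup p k))"
proof (rule poly_mapping_eqI)
  fix l
  show "Poly_Mapping.lookup p l =
    Poly_Mapping.lookup (\<Sum>k\<in>Poly_Mapping.keys p. Poly_Mapping.single k (Poly_Mapping.lookup p k)) l"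
    by (cases "l \<in> Poly_Mapping.keys p")
       (auto simp: lookup_sum lookup_single when_def in_keys_iff sum.delta')
qed

lemma mpoly_mult_monomials:
  fixes p q :: "'a::comm_ring_1 mpoly"
  shows "p * q = (\<Sum>k\<in>Poly_Mapping.keys p. \<Sum>l\<in>Poly_Mapping.keys q.
     Poly_Mapping.single (k + l) (Poly_Mapping.lookup p k * Poly_Mapping.lookup q l))"
  by (subst poly_mapping_monomials[of p], subst poly_mapping_monomials[of q])
     (simp add: sum_product mult_single)

lemma ev_mult [simp]: "ev (p * q) x = ev p x * ev q x"
proof -
  have "ev (p * q) x = (\<Sum>k\<in>Poly_Mapping.keys p. \<Sum>l\<in>Poly_Mapping.keys q.
     (Poly_Mapping.lookup p k * mon k x) * (Poly_Mapping.lookup q l * mon l x))"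
    by (subst mpoly_mult_monomials) (simp add: ev_single mon_add mult_ac)
  also have "\<dots> = ev p x * ev q x"
    by (simp add: ev_superset[OF finite_keys order_refl] sum_product)
  finally show ?thesis .
qed

lemma ev_mconst [simp]: "ev (mconst c) x = c"
  by (simp add: mconst_def ev_single mon_def)

lemma ev_1 [simp]: "ev 1 x = 1"
  using ev_mconst[of 1 x] by (simp add: mconst_def)

lemma ev_mvar [simp]: "ev (mvar i) x = x i"
  by (simp add: mvar_def ev_single mon_def)

lemma ev_prod [simp]: "ev (prod f A) x = (\<Prod>a\<in>A. ev (f a) x)"
  by (induction A rule: infinite_finite_induct) auto

lemma ev_power [simp]: "ev (p ^ k) x = ev p x ^ k"
  by (induction k) auto

lemma ev_uminus [simp]: "ev (- p) x = - ev p x"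
  using ev_add[of p "- p" x] by (simp add: eq_neg_iff_add_eq_0 add.commute)

lemma ev_diff [simp]: "ev (p - q) x = ev p x - ev q x"
  using ev_add[of p "- q" x] by simp

lemma ev_poly_eval_mconst: "ev (poly_eval mconst p G) x = ev p (\<lambda>i. ev (G i) x)"
  unfolding poly_eval_def[of mconst] ev_superset[OF finite_keys order_refl, of p] by (simp add: mon_def)

lemma ev_cong:
  assumes "mvars p \<subseteq> V" "\<And>i. i \<in> V \<Longrightarrow> x i = y i"
  shows "ev p x = ev p y"
proof -
  have "mon k x = mon k y" if "k \<in> Poly_Mapping.keys p" for k
    unfolding mon_def using that assms by (intro prod.cong) (auto simp: mvars_def)
  then show ?thesis
    unfolding ev_superset[OF finite_keys order_refl] by (intro sum.cong) auto
qed

text \<open>Serves both for \<open>Fq q\<close> and for the intermediate fixed fields, in which the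
  coefficients of Lagrange polynomials lie before the trace is taken.\<close>

definition subring_set :: "'a::comm_ring_1 set \<Rightarrow> bool" where
  "subring_set K \<longleftrightarrow> 0 \<in> K \<and> 1 \<in> K \<and> (\<forall>x\<in>K. - x \<in> K) \<and> (\<forall>x\<in>K. \<forall>y\<in>K. x + y \<in> K \<and> x * y \<in> K)"

context
  fixes K :: "'a::comm_ring_1 set" and V :: "nat set"
  assumes K: "subring_set K"
begin

lemma poly_over_single:
  "c \<in> K \<Longrightarrow> Poly_Mapping.keys k \<subseteq> V \<Longrightarrow> poly_over K V (Poly_Mapping.single k c)"
  using K by (auto simp: poly_over_def mvars_def lookup_single when_def subring_set_def split: if_splits)

lemma poly_over_mconst: "c \<in> K \<Longrightarrow> poly_over K V (mconst c)"
  unfolding mconst_def by (rule poly_over_single) auto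

lemma poly_over_0: "poly_over K V 0"
  using K by (auto simp: poly_over_def mvars_def subring_set_def)

lemma poly_over_1: "poly_over K V 1"
  using poly_over_mconst[of 1] K by (simp add: mconst_def subring_set_def)

lemma poly_over_mvar: "i \<in> V \<Longrightarrow> poly_over K V (mvar i)"
  unfolding mvar_def using K by (intro poly_over_single) (auto simp: subring_set_def)

lemma poly_over_add: "poly_over K V p \<Longrightarrow> poly_over K V q \<Longrightarrow> poly_over K V (p + q)"
  using K keys_add[of p q] unfolding poly_over_def mvars_def subring_set_def
  by (simp add: lookup_add) blast

lemma poly_over_uminus: "poly_over K V p \<Longrightarrow> poly_over K V (- p)"
proof -
  have "Poly_Mapping.keys (- p) = Poly_Mapping.keys p" by (auto simp: in_keys_iff)
  then show "poly_over K V p \<Longrightarrow> poly_over K V (- p)"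
    using K unfolding poly_over_def mvars_def subring_set_def by simp
qed

lemma poly_over_diff: "poly_over K V p \<Longrightarrow> poly_over K V q \<Longrightarrow> poly_over K V (p - q)"
  using poly_over_add[OF _ poly_over_uminus, of p q] by simp

lemma poly_over_sum: "(\<And>a. a \<in> A \<Longrightarrow> poly_over K V (f a)) \<Longrightarrow> poly_over K V (sum f A)"
  by (induction A rule: infinite_finite_induct) (simp_all add: poly_over_0 poly_over_add)

lemma poly_over_mult:
  assumes "poly_over K V p" "poly_over K V q" shows "poly_over K V (p * q)"
proof -
  have "Poly_Mapping.keys (k + l) \<subseteq> V"
    if "k \<in> Poly_Mapping.keys p" "l \<in> Poly_Mapping.keys q" for k l
  proof -
    have "Poly_Mapping.keys k \<subseteq> V" "Poly_Mapping.keys l \<subseteq> V"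
      using that assms unfolding poly_over_def mvars_def by blast+
    then show ?thesis using keys_add[of k l] by blast
  qed
  moreover have "Poly_Mapping.lookup p k * Poly_Mapping.lookup q l \<in> K" for k l
    using assms K unfolding poly_over_def subring_set_def by blast
  ultimately show ?thesis
    by (subst mpoly_mult_monomials) (intro poly_over_sum poly_over_single; blast)
qed

lemma poly_over_prod: "(\<And>a. a \<in> A \<Longrightarrow> poly_over K V (f a)) \<Longrightarrow> poly_over K V (prod f A)"
  by (induction A rule: infinite_finite_induct) (simp_all add: poly_over_1 poly_over_mult)

lemma poly_over_power: "poly_over K V p \<Longrightarrow> poly_over K V (p ^ k)"
  by (induction k) (simp_all add: poly_over_1 poly_over_mult)

lemma poly_over_poly_eval:
  assumes "poly_over K W p" "\<And>i. i \<in> W \<Longrightarrow> poly_over K V (G i)"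
  shows "poly_over K V (poly_eval mconst p G)"
  unfolding poly_eval_def using assms
  by (intro poly_over_sum poly_over_mult poly_over_mconst poly_over_prod poly_over_power)
     (auto simp: poly_over_def mvars_def)

end

lemma poly_over_mono: "poly_over K V p \<Longrightarrow> K \<subseteq> K' \<Longrightarrow> V \<subseteq> V' \<Longrightarrow> poly_over K' V' p"
  by (auto simp: poly_over_def)

section \<open>Frobenius powers on a finite field\<close>

locale frobenius_field =
  fixes q m :: nat and ty :: "'a::{field,finite} itself"
  assumes q_prime_power: "\<exists>p k. prime p \<and> k \<ge> 1 \<and> q = p ^ k"
    and m_ge: "m \<ge> 1"
    and card_field: "card (UNIV :: 'a set) = q ^ m"
begin

definition fr :: "nat \<Rightarrow> 'a \<Rightarrow> 'a" where
  "fr j x = x ^ q ^ j"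

lemma q_ge: "q \<ge> 2"
proof -
  obtain p k where pk: "prime p" "k \<ge> 1" "q = p ^ k" using q_prime_power by blast
  have "p ^ 1 \<le> p ^ k"
    using pk prime_ge_2_nat[of p] by (intro power_increasing) auto
  then show ?thesis using pk prime_ge_2_nat[of p] by simp
qed

lemma q_char: "\<exists>k. q = CHAR('a) ^ k" and prime_char: "prime CHAR('a)"
proof -
  obtain p k where pk: "prime p" "k \<ge> 1" "q = p ^ k" using q_prime_power by blast
  show prime: "prime CHAR('a)"
    using finite_imp_CHAR_pos[where 'a='a] prime_CHAR_semidom[where 'a='a] by simp
  have "CHAR('a) dvd p ^ (k * m)"
    using CHAR_dvd_CARD[where 'a='a] card_field pk by (simp add: power_mult)
  then have "CHAR('a) = p"
    using prime pk(1) by (meson prime_dvd_power primes_dvd_imp_eq)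
  then show "\<exists>k. q = CHAR('a) ^ k" using pk by blast
qed

lemma fr_add [simp]: "fr j (x + y) = fr j x + fr j y"
proof -
  obtain k where "q = CHAR('a) ^ k" using q_char by blast
  then have "q ^ j = CHAR('a) ^ (k * j)" by (simp add: power_mult)
  then show ?thesis unfolding fr_def using freshmans_dream'[OF prime_char] by blast
qed

lemma fr_0 [simp]: "fr j 0 = 0"
  using q_ge by (simp add: fr_def)

lemma fr_1 [simp]: "fr j 1 = 1"
  by (simp add: fr_def)

lemma fr_uminus [simp]: "fr j (- x) = - fr j x"
  using fr_add[of j x "- x"] by (simp add: eq_neg_iff_add_eq_0 add.commute)

lemma fr_diff [simp]: "fr j (x - y) = fr j x - fr j y"
  using fr_add[of j x "- y"] by simp

lemma fr_mult [simp]: "fr j (x * y) = fr j x * fr j y"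
  by (simp add: fr_def power_mult_distrib)

lemma fr_power [simp]: "fr j (x ^ k) = fr j x ^ k"
  by (simp add: fr_def mult.commute flip: power_mult)

lemma fr_sum: "fr j (sum f A) = (\<Sum>a\<in>A. fr j (f a))"
  by (induction A rule: infinite_finite_induct) auto

lemma fr_prod: "fr j (prod f A) = (\<Prod>a\<in>A. fr j (f a))"
  by (induction A rule: infinite_finite_induct) auto

lemma fr_zero [simp]: "fr 0 x = x"
  by (simp add: fr_def)

lemma fr_comp: "fr (i + j) x = fr i (fr j x)"
  by (simp add: fr_def power_add mult.commute flip: power_mult)

lemma fr_m [simp]: "fr m x = x"
proof (cases "x = 0")
  case False
  \<comment> \<open>Multiplication by \<open>x\<close> permutes the nonzero elements, so comparing
    the products of all of them gives Fermat's identity.\<close>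
  let ?P = "\<Prod>y\<in>UNIV - {0 :: 'a}. y"
  have "?P = (\<Prod>y\<in>UNIV - {0}. x * y)"
    by (rule prod.reindex_bij_witness[of _ "\<lambda>y. x * y" "\<lambda>y. y / x"]) (use False in auto)
  also have "\<dots> = x ^ (q ^ m - 1) * ?P"
    by (simp add: prod.distrib card_field card_Diff_singleton)
  finally have "x ^ (q ^ m - 1) = 1"
    by simp
  moreover have "q ^ m = Suc (q ^ m - 1)" using q_ge by simp
  ultimately have "x ^ q ^ m = x"
    by (metis power_Suc mult_1_right)
  then show ?thesis by (simp add: fr_def)
qed (use q_ge in \<open>simp add: fr_def\<close>)

text \<open>This power is the indicator of the nonzero elements, from which the Lagrange polynomials
  are built.\<close>

lemma power_card_minus_1: "(x :: 'a) ^ (q ^ m - 1) = (if x = 0 then 0 else 1)"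
proof (cases "x = 0")
  case True
  have "q ^ m \<ge> q ^ 1" using q_ge m_ge by (intro power_increasing) auto
  then show ?thesis using True q_ge by (simp add: power_0_left)
next
  case False
  have "Suc (q ^ m - 1) = q ^ m" using q_ge by simp
  then have "x * x ^ (q ^ m - 1) = x"
    using fr_m[of x] unfolding fr_def by (metis power_Suc)
  then show ?thesis using False by simp
qed

lemma fr_eq_iff [simp]: "fr j x = fr j y \<longleftrightarrow> x = y"
proof -
  have "x = y" if "fr j x = fr j y"
  proof -
    have "fr j (x - y) = 0" using that by simp
    then show ?thesis using q_ge by (simp add: fr_def)
  qed
  then show ?thesis by blast
qed

lemma fr_fix_dvd: "fr d x = x \<Longrightarrow> d dvd j \<Longrightarrow> fr j x = x"
proof -
  assume d: "fr d x = x" "d dvd j"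
  have "fr (k * d) x = x" for k using d(1) by (induction k) (auto simp: fr_comp)
  then show "fr j x = x" using d(2) by (metis dvd_def mult.commute)
qed

text \<open>\<open>d\<close> is the degree over F_q of the field generated by the values
  \<open>p l\<close> with \<open>l\<close> in \<open>V\<close>. A one-point \<open>V\<close> gives
  the degree of a single element.\<close>

lemma fr_period:
  fixes p :: "'i \<Rightarrow> 'a"
  obtains d where "d > 0" "d dvd m" "\<And>j. (\<forall>l\<in>V. fr j (p l) = p l) \<longleftrightarrow> d dvd j"
proof -
  have shift: "(\<forall>l\<in>V. fr (i + j) (p l) = p l) \<longleftrightarrow> (\<forall>l\<in>V. fr j (p l) = p l)"
    if "\<forall>l\<in>V. fr i (p l) = p l" for i j
    using that by (simp add: add.commute[of i] fr_comp)
  have "m > 0" using m_ge by simp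
  with period_exists[of "\<lambda>j. \<forall>l\<in>V. fr j (p l) = p l" m, OF shift] fr_m
  obtain d where d: "d > 0" "\<And>j. (\<forall>l\<in>V. fr j (p l) = p l) \<longleftrightarrow> d dvd j"
    by metis
  then have "d dvd m" using fr_m by blast
  then show ?thesis using that d by blast
qed

section \<open>Sizes of the fixed fields of Frobenius powers\<close>

lemma card_fixed_le:
  assumes "j > 0" shows "card {x. fr j x = x} \<le> q ^ j"
proof -
  let ?p = "monom 1 (q ^ j) - monom 1 1 :: 'a poly"
  have gt: "q ^ j > 1" using one_less_power[of q j] assms q_ge by linarith
  have "coeff ?p (q ^ j) = 1" using gt by simp
  then have nz: "?p \<noteq> 0" by (metis coeff_0 zero_neq_one)
  have "degree ?p \<le> q ^ j"
    using gt by (intro degree_diff_le) (auto intro: order.trans[OF degree_monom_le])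
  moreover have "{x. fr j x = x} = {x. poly ?p x = 0}"
    by (auto simp: fr_def poly_monom)
  ultimately show ?thesis using card_poly_roots_bound[OF nz] by simp
qed

text \<open>The kernel of \<open>\<sigma>\<^sup>d - 1\<close> is large because its image lies in the kernel of the relative trace,
  which is the zero set of a polynomial of degree at most \<open>q\<^bsup>m - d\<^esup>\<close>.\<close>

lemma card_fixed_ge:
  assumes d: "d dvd m" shows "card {x. fr d x = x} \<ge> q ^ d"
proof -
  obtain e where e: "m = d * e" using d by blast
  have pos: "d > 0" "e > 0" using e m_ge by (cases d; cases e; simp)+
  let ?K = "{x. fr d x = x}"
  let ?phi = "\<lambda>x. fr d x - x"
  let ?p = "(\<Sum>i<e. monom 1 (q ^ (d * i))) :: 'a poly"
  have inj: "q ^ (d * i) = q ^ (d * j) \<longleftrightarrow> i = j" for i j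
    using q_ge pos by simp
  have "coeff ?p (q ^ (d * 0)) = 1"
    unfolding coeff_sum coeff_monom inj using pos by simp
  then have nz: "?p \<noteq> 0" by (metis coeff_0 zero_neq_one)
  have deg: "degree ?p \<le> q ^ (m - d)"
  proof (rule degree_sum_le)
    fix i assume i: "i \<in> {..<e}"
    then have "d * i \<le> d * (e - 1)" by (intro mult_le_mono) auto
    then have "d * i \<le> m - d" using e by (simp add: right_diff_distrib')
    then have "q ^ (d * i) \<le> q ^ (m - d)" using q_ge by (intro power_increasing) auto
    then show "degree (monom 1 (q ^ (d * i)) :: 'a poly) \<le> q ^ (m - d)"
      using degree_monom_le order.trans by blast
  qed simp
  have "poly ?p (?phi x) = 0" for x
  proof -
    have "poly ?p (?phi x) = (\<Sum>i<e. fr (d * i) (?phi x))"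
      by (simp add: poly_sum poly_monom fr_def)
    also have "\<dots> = (\<Sum>i<e. fr (d * Suc i) x - fr (d * i) x)"
      by (simp add: fr_comp add.commute[of d])
    also have "\<dots> = fr (d * e) x - fr (d * 0) x"
      by (rule sum_lessThan_telescope)
    finally show ?thesis using fr_m[of x] by (simp add: e)
  qed
  then have "range ?phi \<subseteq> {x. poly ?p x = 0}" by blast
  then have "card (range ?phi) \<le> q ^ (m - d)"
    using card_poly_roots_bound[OF nz] deg card_mono[OF finite, of "range ?phi"] by (meson order.trans)
  \<comment> \<open>Each fibre is empty or a translate of the kernel, so the order of the field is
    at most the product of the sizes of image and kernel.\<close>
  have fib: "card {x. ?phi x = y} \<le> card ?K" for y
  proof (cases "\<exists>x. ?phi x = y")
    case True
    then obtain z where z: "?phi z = y" by blast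
    show ?thesis
      by (rule card_inj_on_le[of "\<lambda>x. x - z"]) (use z in \<open>auto simp: inj_on_def algebra_simps\<close>)
  next
    case False
    then have "{x. ?phi x = y} = {}" by blast
    then show ?thesis by simp
  qed
  have "UNIV = (\<Union>y\<in>range ?phi. {x. ?phi x = y})" by auto
  then have "q ^ m \<le> (\<Sum>y\<in>range ?phi. card {x. ?phi x = y})"
    using card_UN_le[of "range ?phi" "\<lambda>y. {x. ?phi x = y}"] card_field by simp
  also have "\<dots> \<le> card (range ?phi) * card ?K"
    using sum_bounded_above[of "range ?phi" "\<lambda>y. card {x. ?phi x = y}" "card ?K"] fib by simp
  also have "\<dots> \<le> q ^ (m - d) * card ?K"
    using \<open>card (range ?phi) \<le> q ^ (m - d)\<close> by (rule mult_le_mono1)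
  finally have "q ^ (m - d) * q ^ d \<le> q ^ (m - d) * card ?K"
    using e pos by (simp flip: power_add)
  then show ?thesis using q_ge by simp
qed

lemma sum_powers_less: "(\<Sum>j\<in>{0<..<r}. q ^ j) < q ^ r"
proof (induction r)
  case (Suc r)
  show ?case
  proof (cases "r = 0")
    case False
    then have "{0<..<Suc r} = insert r {0<..<r}" by auto
    then have "(\<Sum>j\<in>{0<..<Suc r}. q ^ j) = q ^ r + (\<Sum>j\<in>{0<..<r}. q ^ j)" by simp
    also have "\<dots> < 2 * q ^ r" using Suc by simp
    also have "\<dots> \<le> q ^ Suc r" using q_ge by simp
    finally show ?thesis .
  next
    case True
    have "{0<..<Suc 0} = {}" by auto
    then show ?thesis using True q_ge by simp
  qed
qed simp

text \<open>Counting: there are at least q^r candidates \<open>c\<close>, while for each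
  \<open>j\<close> with 0 < j < r at most q^j of them make \<open>z + c\<close> fixed by
  \<open>fr j\<close>. The sum of these bounds is below q^r.\<close>

lemma exists_large_period:
  assumes "r dvd m"
  shows "\<exists>c. fr r c = c \<and> (\<forall>j. 0 < j \<longrightarrow> j < r \<longrightarrow> fr j (z + c) \<noteq> z + c)"
proof (rule ccontr)
  assume none: "\<not> ?thesis"
  have *: "\<exists>j. 0 < j \<and> j < r \<and> fr j (z + c) = z + c" if "fr r c = c" for c
    using none that by blast
  have "{c. fr r c = c} \<subseteq> (\<Union>j\<in>{0<..<r}. {c. fr j (z + c) = z + c})"
  proof
    fix c assume "c \<in> {c. fr r c = c}"
    then obtain j where "0 < j" "j < r" "fr j (z + c) = z + c"
      using * by blast
    then show "c \<in> (\<Union>j\<in>{0<..<r}. {c. fr j (z + c) = z + c})"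
      by (intro UN_I[of j]) auto
  qed
  then have "q ^ r \<le> card (\<Union>j\<in>{0<..<r}. {c. fr j (z + c) = z + c})"
    using card_fixed_ge[OF assms] card_mono[OF finite] order.trans by blast
  also have "\<dots> \<le> (\<Sum>j\<in>{0<..<r}. card {c. fr j (z + c) = z + c})"
    by (rule card_UN_le) simp
  also have "\<dots> \<le> (\<Sum>j\<in>{0<..<r}. q ^ j)"
  proof (rule sum_mono)
    fix j assume j: "j \<in> {0<..<r}"
    have "card {c. fr j (z + c) = z + c} \<le> card {x. fr j x = x}"
      by (rule card_inj_on_le[of "\<lambda>c. z + c"]) (auto simp: inj_on_def)
    also have "\<dots> \<le> q ^ j" using card_fixed_le j by simp
    finally show "card {c. fr j (z + c) = z + c} \<le> q ^ j" .
  qed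
  also have "\<dots> < q ^ r" by (rule sum_powers_less)
  finally show False by simp
qed

lemma exists_generator:
  assumes d: "d dvd m"
  obtains c where "c \<noteq> 0" "\<And>j. fr j c = c \<longleftrightarrow> d dvd j"
\<comment> \<open>For \<open>d = 1\<close> the condition on smaller exponents is vacuous and might
  be met by 0, so 1 is taken instead.\<close>
proof (cases "d = 1")
  case True
  then show ?thesis using that[of 1] by simp
next
  case False
  obtain c where c: "fr d c = c" "\<And>j. 0 < j \<Longrightarrow> j < d \<Longrightarrow> fr j c \<noteq> c"
    using exists_large_period[OF d, of 0] unfolding add_0 by blast
  have d0: "d > 0" using d m_ge by (cases d) auto
  obtain e where e: "e > 0" "\<And>j. fr j c = c \<longleftrightarrow> e dvd j"
    using fr_period[of "{()}" "\<lambda>_. c"] by auto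
  have "e = d"
  proof -
    have "e \<le> d" using c(1) e(2) d0 by (simp add: dvd_imp_le)
    moreover have "fr e c = c" using e(2) by simp
    ultimately show ?thesis using c(2)[of e] e(1) by fastforce
  qed
  moreover have "c \<noteq> 0" using e(2)[of 1] \<open>e = d\<close> False by auto
  ultimately show ?thesis using that e by blast
qed

end

section \<open>Equivariant interpolation\<close>

context frobenius_field begin

lemma subring_fixed: "subring_set {x. fr j x = x}"
  by (simp add: subring_set_def)

lemma Fq_eq: "(Fq q :: 'a set) = {x. fr 1 x = x}"
  by (simp add: Fq_def fr_def)

lemma mon_fr: "(\<And>i. i \<in> Poly_Mapping.keys k \<Longrightarrow> x i = fr j (y i)) \<Longrightarrow> mon k x = fr j (mon k y)"
  by (simp add: mon_def fr_prod)

lemma ev_fr: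
  assumes "poly_over (Fq q) V p" "\<And>i. i \<in> V \<Longrightarrow> x i = fr j (y i)"
  shows "ev p x = fr j (ev p y)"
proof -
  have "fr j (Poly_Mapping.lookup p k) = Poly_Mapping.lookup p k" for k
    using assms(1) fr_fix_dvd[of 1 _ j] by (simp add: poly_over_def Fq_eq)
  moreover have "mon k x = fr j (mon k y)" if "k \<in> Poly_Mapping.keys p" for k
    using that assms by (intro mon_fr) (auto simp: poly_over_def mvars_def)
  ultimately show ?thesis
    unfolding ev_superset[OF finite_keys order_refl] fr_sum by (intro sum.cong) auto
qed

text \<open>The Lagrange polynomial of \<open>p\<close> has coefficients in the field \<open>k(p, c)\<close>; applying the trace
  to its coefficients averages it over the Galois orbit of \<open>p\<close>.\<close>

lemma equivariant_interpolation:
  fixes p :: "nat \<Rightarrow> 'a"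
  assumes V: "finite V" and c: "\<And>j. \<forall>l\<in>V. fr j (p l) = p l \<Longrightarrow> fr j c = c"
  shows "\<exists>f. poly_over (Fq q) V f \<and>
    (\<forall>x j. (\<forall>l\<in>V. x l = fr j (p l)) \<longrightarrow> ev f x = fr j c) \<and>
    (\<forall>x. (\<forall>j. \<exists>l\<in>V. x l \<noteq> fr j (p l)) \<longrightarrow> ev f x = 0)"
proof -
  obtain e where e: "e > 0" "e dvd m" "\<And>j. (\<forall>l\<in>V. fr j (p l) = p l) \<longleftrightarrow> e dvd j"
    using fr_period[of V p] by blast
  define K where "K = {x. fr e x = x}"
  have K: "subring_set K" unfolding K_def by (rule subring_fixed)
  have pK: "l \<in> V \<Longrightarrow> p l \<in> K" for l using e(3)[of e] by (simp add: K_def)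
  have cK: "c \<in> K" using c[of e] e(3)[of e] by (simp add: K_def)
  \<comment> \<open>The factor for \<open>l\<close> is 1 where the variable equals
    \<open>p l\<close> and 0 elsewhere.\<close>
  define g where "g = mconst c * (\<Prod>l\<in>V. 1 - (mvar l - mconst (p l)) ^ (q ^ m - 1))"
  have gK: "poly_over K V g"
    unfolding g_def
    by (intro poly_over_mult[OF K] poly_over_prod[OF K] poly_over_diff[OF K] poly_over_power[OF K]
        poly_over_mconst[OF K] poly_over_mvar[OF K] poly_over_1[OF K] cK pK)
  have evg: "ev g x = (if \<forall>l\<in>V. x l = p l then c else 0)" for x
  proof -
    have "ev g x = c * (\<Prod>l\<in>V. if x l = p l then 1 else 0)"
      unfolding g_def ev_mult ev_prod ev_diff ev_power ev_1 ev_mvar ev_mconst power_card_minus_1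
      by (intro arg_cong[of _ _ "(*) c"] prod.cong) auto
    then show ?thesis using V by (auto simp: prod_zero_iff intro!: prod.neutral)
  qed
  define tr where "tr u = (\<Sum>j<e. fr j u)" for u
  have tr_Fq: "tr u \<in> Fq q" if "u \<in> K" for u
  proof -
    have "fr 1 (tr u) = (\<Sum>j<e. fr (Suc j) u)"
      by (simp add: tr_def fr_sum flip: fr_comp)
    also have "\<dots> = (\<Sum>j<e. fr j u) + fr e u - fr 0 u"
      using sum.lessThan_Suc_shift[of "\<lambda>j. fr j u" e] sum.lessThan_Suc[of "\<lambda>j. fr j u" e]
      by (simp add: algebra_simps)
    also have "\<dots> = tr u" using that by (simp add: K_def tr_def)
    finally show ?thesis by (simp add: Fq_eq)
  qed
  define f where "f = (\<Sum>k\<in>Poly_Mapping.keys g.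
    Poly_Mapping.single k (tr (Poly_Mapping.lookup g k)))"
  have Fq_ring: "subring_set (Fq q :: 'a set)" unfolding Fq_eq by (rule subring_fixed)
  have fK: "poly_over (Fq q) V f"
    unfolding f_def using gK
    by (intro poly_over_sum[OF Fq_ring] poly_over_single[OF Fq_ring] tr_Fq)
       (auto simp: poly_over_def mvars_def)
  have evf: "ev f x = (\<Sum>j<e. if \<forall>l\<in>V. x l = fr j (p l) then fr j c else 0)" for x
  proof -
    \<comment> \<open>Applying \<open>fr j\<close> to the coefficients only is the same as
      conjugating the argument back, evaluating, and conjugating the value;
      \<open>fr (m - j)\<close> is the inverse of \<open>fr j\<close>.\<close>
    have 1: "fr j (Poly_Mapping.lookup g k) * mon k x
      = fr j (Poly_Mapping.lookup g k * mon k (\<lambda>l. fr (m - j) (x l)))" if "j < e" for j k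
    proof -
      have "j \<le> m" using that e(2) m_ge dvd_imp_le[of e m] by linarith
      then have "x l = fr j (fr (m - j) (x l))" for l by (simp flip: fr_comp)
      then have "mon k x = fr j (mon k (\<lambda>l. fr (m - j) (x l)))" by (intro mon_fr)
      then show ?thesis by simp
    qed
    have "ev f x = (\<Sum>k\<in>Poly_Mapping.keys g. \<Sum>j<e. fr j (Poly_Mapping.lookup g k) * mon k x)"
      by (simp add: f_def ev_single tr_def sum_distrib_right)
    also have "\<dots> = (\<Sum>j<e. \<Sum>k\<in>Poly_Mapping.keys g. fr j (Poly_Mapping.lookup g k) * mon k x)"
      by (rule sum.swap)
    also have "\<dots> = (\<Sum>j<e. fr j (ev g (\<lambda>l. fr (m - j) (x l))))"
      by (intro sum.cong refl) (simp only: 1 lessThan_iff ev_superset[OF finite_keys order_refl] fr_sum)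
    also have "\<dots> = (\<Sum>j<e. if \<forall>l\<in>V. x l = fr j (p l) then fr j c else 0)"
    proof (intro sum.cong refl)
      fix j assume "j \<in> {..<e}"
      then have "j \<le> m" using e(2) m_ge dvd_imp_le[of e m] by simp
      then have "fr (m - j) (x l) = p l \<longleftrightarrow> x l = fr j (p l)" for l
        using fr_eq_iff[of j "fr (m - j) (x l)" "p l"] by (simp flip: fr_comp)
      then show "fr j (ev g (\<lambda>l. fr (m - j) (x l))) = (if \<forall>l\<in>V. x l = fr j (p l) then fr j c else 0)"
        by (simp add: evg)
    qed
    finally show ?thesis .
  qed
  have mod: "fr j y = fr (j mod e) y" if "fr e y = y" for j y
  proof -
    have "fr (j mod e + e * (j div e)) y = fr (j mod e) (fr (e * (j div e)) y)" by (rule fr_comp)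
    then show ?thesis using fr_fix_dvd[OF that, of "e * (j div e)"] by simp
  qed
  \<comment> \<open>The \<open>e\<close> conjugates of \<open>p\<close> on \<open>V\<close> are
    distinct, so at most one term of the averaged sum survives at any argument.\<close>
  have uniq: "i = j" if "i < e" "j < e" "\<forall>l\<in>V. fr i (p l) = fr j (p l)" "i \<le> j" for i j
  proof -
    have "fr i (fr (j - i) (p l)) = fr i (p l)" if "l \<in> V" for l
      using that \<open>i \<le> j\<close> \<open>\<forall>l\<in>V. fr i (p l) = fr j (p l)\<close> unfolding fr_comp[symmetric]
      by simp
    then have "e dvd j - i" using e(3)[of "j - i"] unfolding fr_eq_iff by blast
    moreover have "j - i < e" using that by simp
    ultimately have "j - i = 0" by (metis dvd_imp_le linorder_not_less neq0_conv)
    then show ?thesis using that by simp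
  qed
  show ?thesis
  proof (intro exI[of _ f] conjI allI impI fK)
    fix x j assume x: "\<forall>l\<in>V. x l = fr j (p l)"
    let ?i = "j mod e"
    have i: "?i < e" "\<And>l. l \<in> V \<Longrightarrow> x l = fr ?i (p l)"
      using e(1) x mod[of "p _" j] pK unfolding K_def by simp_all
    have "(\<forall>l\<in>V. x l = fr k (p l)) \<longleftrightarrow> k = ?i" if "k < e" for k
      using uniq[of k ?i] uniq[of ?i k] i that by (metis linear)
    then have "ev f x = (\<Sum>k<e. if k = ?i then fr k c else 0)"
      unfolding evf by (intro sum.cong) auto
    also have "\<dots> = fr ?i c" using i(1) by simp
    also have "\<dots> = fr j c" using mod[of c j] cK by (simp add: K_def)
    finally show "ev f x = fr j c" .
  next
    fix x assume "\<forall>j. \<exists>l\<in>V. x l \<noteq> fr j (p l)"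
    then show "ev f x = 0" unfolding evf by (intro sum.neutral) metis
  qed
qed

end

section \<open>The group induced by the tame automorphisms\<close>

locale tame_group = frobenius_field q m ty for q m and ty :: "'a::{field,finite} itself" +
  fixes n :: nat
  assumes n_ge: "n \<ge> 3"
begin

definition actp :: "nat \<Rightarrow> (nat \<Rightarrow> 'a) \<Rightarrow> nat \<Rightarrow> 'a" where
  "actp j x = (\<lambda>i\<in>{..<n}. fr j (x i))"

definition tame :: "((nat \<Rightarrow> 'a) \<Rightarrow> nat \<Rightarrow> 'a) set" where
  "tame = induced n ` TA n q"

lemma Pts_eqI: "x \<in> Pts n \<Longrightarrow> y \<in> Pts n \<Longrightarrow> (\<And>i. i < n \<Longrightarrow> x i = y i) \<Longrightarrow> x = (y :: nat \<Rightarrow> 'a)"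
  unfolding Pts_def by (rule PiE_ext) auto

lemma restrict_Pts [simp]: "(\<lambda>i\<in>{..<n}. f i) \<in> Pts n"
  by (simp add: Pts_def)

lemma finite_Pts: "finite (Pts n :: (nat \<Rightarrow> 'a) set)"
  unfolding Pts_def by (intro finite_PiE) auto

lemma actp_Pts [simp]: "actp j x \<in> Pts n"
  by (simp add: actp_def)

lemma actp_apply [simp]: "i < n \<Longrightarrow> actp j x i = fr j (x i)"
  by (simp add: actp_def)

lemma induced_Pts [simp]: "x \<in> Pts n \<Longrightarrow> induced n F x \<in> Pts n"
  by (simp add: induced_def)

lemma induced_apply [simp]: "x \<in> Pts n \<Longrightarrow> i < n \<Longrightarrow> induced n F x i = ev (F i) x"
  by (simp add: induced_def ev_def)

lemma Fq_ring: "subring_set (Fq q :: 'a set)"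
  unfolding Fq_eq by (rule subring_fixed)

lemma TA_poly_over:
  assumes "(F :: nat \<Rightarrow> 'a mpoly) \<in> TA n q"
  shows "i < n \<Longrightarrow> poly_over (Fq q) {..<n} (F i)"
  using assms
proof (induction arbitrary: i)
  case (aff F)
  then obtain A b where "\<And>i j. A i j \<in> Fq q" "\<And>i. b i \<in> Fq q"
    and F: "\<And>i. F i = (if i < n then (\<Sum>j<n. mconst (A i j) * mvar j) + mconst (b i) else 0)"
    unfolding affine_maps_def by blast
  then show ?case
    unfolding F by (auto intro!: poly_over_add[OF Fq_ring] poly_over_sum[OF Fq_ring]
        poly_over_mult[OF Fq_ring] poly_over_mconst[OF Fq_ring] poly_over_mvar[OF Fq_ring]
        poly_over_0[OF Fq_ring])
next
  case (tri F)
  then obtain a f where "\<And>i. i < n \<Longrightarrow> a i \<in> Fq q"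
    and f: "\<And>i. i < n \<Longrightarrow> poly_over (Fq q) {Suc i..<n} (f i)"
    and F: "\<And>i. F i = (if i < n then mconst (a i) * mvar i + f i else 0)"
    unfolding triangular_maps_def by blast
  moreover have "poly_over (Fq q) {..<n} (f i)" if "i < n"
    using f[OF that] by (rule poly_over_mono) auto
  ultimately show ?case
    using tri.prems by (auto intro!: poly_over_add[OF Fq_ring]
        poly_over_mult[OF Fq_ring] poly_over_mconst[OF Fq_ring] poly_over_mvar[OF Fq_ring])
next
  case (comp F G)
  then show ?case
    by (auto simp: pcomp_def intro!: poly_over_poly_eval[OF Fq_ring])
qed

lemma induced_pcomp:
  assumes F: "F \<in> TA n q" and x: "x \<in> Pts n"
  shows "induced n (pcomp n F G) x = induced n F (induced n G (x :: nat \<Rightarrow> 'a))"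
proof (rule Pts_eqI)
  fix i assume i: "i < n"
  have "mvars (F i) \<subseteq> {..<n}" using TA_poly_over[OF F i] by (simp add: poly_over_def)
  then have "ev (F i) (induced n G x) = ev (F i) (\<lambda>i. ev (G i) x)"
    by (rule ev_cong) (use x in simp)
  then show "induced n (pcomp n F G) x i = induced n F (induced n G x) i"
    using i x by (simp add: pcomp_def ev_poly_eval_mconst)
qed (use x in auto)

lemma induced_actp:
  assumes F: "\<And>i. i < n \<Longrightarrow> poly_over (Fq q) {..<n} (F i)" and x: "x \<in> Pts n"
  shows "induced n F (actp j x) = actp j (induced n F x)"
proof (rule Pts_eqI)
  fix i assume i: "i < n"
  have "ev (F i) (actp j x) = fr j (ev (F i) x)"
    using F[OF i] by (rule ev_fr) simp
  then show "induced n F (actp j x) i = actp j (induced n F x) i"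
    using i x by simp
qed (use x in auto)

text \<open>Affine maps are undone by the matrix \<open>B\<close>. For triangular maps the
  coordinates are recovered from the last one downwards, since \<open>f i\<close> involves only
  later variables. Surjectivity then follows from the finiteness of \<open>Pts n\<close>.\<close>

lemma induced_inj:
  assumes "(F :: nat \<Rightarrow> 'a mpoly) \<in> TA n q" shows "inj_on (induced n F) (Pts n)"
  using assms
proof induction
  case (aff F)
  then obtain A B b
    where BA: "\<forall>i<n. \<forall>j<n. (\<Sum>k<n. B i k * A k j) = (if i = j then 1 else 0)"
    and F: "\<And>i. F i = (if i < n then (\<Sum>j<n. mconst (A i j) * mvar j) + mconst (b i) else 0)"
    unfolding affine_maps_def by blast
  show ?case
  proof (rule inj_onI, rule Pts_eqI)
    fix x y i assume x: "x \<in> Pts n" and y: "y \<in> Pts n" and xy: "induced n F x = induced n F y"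
      and i: "i < n"
    have "(\<Sum>j<n. A k j * x j) = (\<Sum>j<n. A k j * y j)" if "k < n" for k
      using fun_cong[OF xy, of k] that x y by (simp add: F)
    then have eq: "(\<Sum>k<n. B i k * (\<Sum>j<n. A k j * x j)) = (\<Sum>k<n. B i k * (\<Sum>j<n. A k j * y j))"
      by simp
    have "(\<Sum>k<n. B i k * (\<Sum>j<n. A k j * z j)) = z i" for z
    proof -
      have "(\<Sum>k<n. B i k * (\<Sum>j<n. A k j * z j)) = (\<Sum>k<n. \<Sum>j<n. B i k * A k j * z j)"
        by (simp add: sum_distrib_left mult.assoc)
      also have "\<dots> = (\<Sum>j<n. (\<Sum>k<n. B i k * A k j) * z j)"
        by (subst sum.swap) (simp add: sum_distrib_right)
      also have "\<dots> = (\<Sum>j<n. if i = j then z j else 0)"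
        using BA i by (intro sum.cong) auto
      finally show ?thesis using i by simp
    qed
    then show "x i = y i" using eq by simp
  qed
next
  case (tri F)
  then obtain a f where a: "\<And>i. i < n \<Longrightarrow> a i \<noteq> 0"
    and f: "\<And>i. i < n \<Longrightarrow> poly_over (Fq q) {Suc i..<n} (f i)"
    and F: "\<And>i. F i = (if i < n then mconst (a i) * mvar i + f i else 0)"
    unfolding triangular_maps_def by blast
  show ?case
  proof (rule inj_onI, rule Pts_eqI)
    fix x y i assume x: "x \<in> Pts n" and y: "y \<in> Pts n" and xy: "induced n F x = induced n F y"
      and i: "i < n"
    show "x i = y i" using i
    proof (induction "n - i" arbitrary: i rule: less_induct)
      case less
      have "x l = y l" if "l \<in> {Suc i..<n}" for l
        using less.hyps[of l] that by (simp add: diff_less_mono2)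
      then have "ev (f i) x = ev (f i) y"
        using f[OF less.prems] by (intro ev_cong) (auto simp: poly_over_def)
      moreover have "ev (F i) x = ev (F i) y"
        using fun_cong[OF xy, of i] less.prems x y by simp
      ultimately show ?case using a less.prems by (simp add: F)
    qed
  qed
next
  case (comp F G)
  show ?case
  proof (rule inj_onI)
    fix x y assume x: "x \<in> Pts n" "y \<in> Pts n"
      and "induced n (pcomp n F G) x = induced n (pcomp n F G) y"
    then have "induced n F (induced n G x) = induced n F (induced n G y)"
      by (simp only: induced_pcomp[OF comp.hyps(1)])
    then have "induced n G x = induced n G y"
      by (rule inj_onD[OF comp.IH(1)]) (use x in auto)
    then show "x = y"
      by (rule inj_onD[OF comp.IH(2)]) (use x in auto)
  qed
qed

section \<open>The induced maps as a finite group of permutations\<close>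

lemma tame_compose: "g \<in> tame \<Longrightarrow> h \<in> tame \<Longrightarrow> compose (Pts n) g h \<in> tame"
proof -
  assume "g \<in> tame" "h \<in> tame"
  then obtain F G where FG: "F \<in> TA n q" "G \<in> TA n q" "g = induced n F" "h = induced n G"
    by (auto simp: tame_def)
  have "compose (Pts n) g h = induced n (pcomp n F G)"
  proof (rule extensionalityI[of _ "Pts n"])
    show "induced n (pcomp n F G) \<in> extensional (Pts n)" unfolding induced_def by simp
    show "compose (Pts n) g h x = induced n (pcomp n F G) x" if "x \<in> Pts n" for x
      using that by (simp add: FG(3,4) compose_def induced_pcomp[OF FG(1)])
  qed (simp add: compose_def)
  then show ?thesis using TA.comp[OF FG(1,2)] by (auto simp: tame_def)
qed

lemma tame_Bij: "tame \<subseteq> Bij (Pts n)"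
proof
  fix h assume "h \<in> tame"
  then obtain F where F: "F \<in> TA n q" "h = induced n F" by (auto simp: tame_def)
  have "h ` Pts n \<subseteq> Pts n" using F by auto
  then have "bij_betw h (Pts n) (Pts n)"
    using induced_inj[OF F(1)] F(2) endo_inj_surj[OF finite_Pts] by (auto simp: bij_betw_def)
  moreover have "h \<in> extensional (Pts n)" by (simp add: F(2) induced_def)
  ultimately show "h \<in> Bij (Pts n)" by (simp add: Bij_def)
qed

lemma finite_tame: "finite tame"
proof (rule finite_subset)
  show "tame \<subseteq> Pts n \<rightarrow>\<^sub>E Pts n"
    using tame_Bij by (auto simp: Bij_def bij_betw_def PiE_def Pi_def)
  show "finite (Pts n \<rightarrow>\<^sub>E Pts n :: ((nat \<Rightarrow> 'a) \<Rightarrow> (nat \<Rightarrow> 'a)) set)"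
    using finite_Pts by (intro finite_PiE) auto
qed

text \<open>A finite set of permutations closed under composition is a group: composing with
  \<open>h\<close> on the right is injective, hence onto, on \<open>tame\<close>. A preimage of
  \<open>h\<close> is the identity \<open>e\<close>, and a preimage of \<open>e\<close> is the
  inverse.\<close>

lemma tame_inverse:
  assumes h: "h \<in> tame" shows "\<exists>k\<in>tame. \<forall>x\<in>Pts n. k (h x) = x \<and> h (k x) = x"
proof -
  have surj: "h ` Pts n = Pts n" and map: "\<And>x. x \<in> Pts n \<Longrightarrow> h x \<in> Pts n"
    using h tame_Bij by (auto simp: Bij_def bij_betw_def)
  have onto_Pts: "\<exists>y\<in>Pts n. x = h y" if "x \<in> Pts n" for x
  proof -
    have "x \<in> h ` Pts n" using that surj by simp
    then show ?thesis by blast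
  qed
  have app: "f (h x) = g (h x)" if "compose (Pts n) f h = compose (Pts n) g h" "x \<in> Pts n" for f g x
    using fun_cong[OF that(1), of x] that(2) by (simp add: compose_def)
  have "inj_on (\<lambda>g. compose (Pts n) g h) tame"
  proof (rule inj_onI)
    fix f g assume f: "f \<in> tame" "g \<in> tame" "compose (Pts n) f h = compose (Pts n) g h"
    have "f x = g x" if "x \<in> Pts n" for x
      using app[OF f(3)] onto_Pts[OF that] by auto
    then show "f = g" using f(1,2) tame_Bij
      by (intro extensionalityI[of f "Pts n"]) (auto simp: Bij_def)
  qed
  moreover have "(\<lambda>g. compose (Pts n) g h) ` tame \<subseteq> tame" using tame_compose h by blast
  ultimately have onto: "(\<lambda>g. compose (Pts n) g h) ` tame = tame"
    using endo_inj_surj[OF finite_tame] by blast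
  then have "h \<in> (\<lambda>g. compose (Pts n) g h) ` tame" using h by metis
  then obtain e where e: "e \<in> tame" "compose (Pts n) e h = h" by (elim imageE) simp
  have "e (h x) = h x" if "x \<in> Pts n" for x
    using fun_cong[OF e(2), of x] that by (simp add: compose_def)
  then have e': "e x = x" if "x \<in> Pts n" for x using onto_Pts[OF that] by auto
  have "e \<in> (\<lambda>g. compose (Pts n) g h) ` tame" using e(1) onto by metis
  then obtain k where k: "k \<in> tame" "compose (Pts n) k h = e" by (elim imageE) simp
  have kh: "k (h x) = x" if "x \<in> Pts n" for x
    using fun_cong[OF k(2), of x] that e' by (simp add: compose_def)
  moreover have "h (k x) = x" if "x \<in> Pts n" for x
    using kh onto_Pts[OF that] by auto
  ultimately show ?thesis using k(1) by blast
qed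

sublocale equivariant_perms "Pts n" actp m tame
proof
  show "m > 0" using m_ge by simp
  show "actp j x \<in> Pts n" for j x by simp
  show "actp 0 x = x" if "x \<in> Pts n" for x
    using that by (intro Pts_eqI) auto
  show "actp (i + j) x = actp i (actp j x)" for i j x
    by (intro Pts_eqI) (auto simp: fr_comp)
  show "actp m x = x" if "x \<in> Pts n" for x
    using that by (intro Pts_eqI) auto
  show "h x \<in> Pts n" if "h \<in> tame" "x \<in> Pts n" for h x
    using that by (auto simp: tame_def)
  show "h (actp j x) = actp j (h x)" if "h \<in> tame" "x \<in> Pts n" for h x j
    using that induced_actp TA_poly_over by (auto simp: tame_def)
  show "\<exists>k\<in>tame. \<forall>x\<in>Pts n. k x = g (h x)" if "g \<in> tame" "h \<in> tame" for g h
    using tame_compose[OF that] by (intro bexI) (auto simp: compose_def)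
  show "\<exists>k\<in>tame. \<forall>x\<in>Pts n. k (h x) = x \<and> h (k x) = x" if "h \<in> tame" for h
    using tame_inverse[OF that] .
qed

section \<open>Tame maps supported on one line and its conjugates\<close>

lemma swap_tame:
  assumes i: "i < n"
  shows "\<exists>h\<in>tame. \<forall>x\<in>Pts n. h x = (\<lambda>k\<in>{..<n}. x (if k = 0 then i else if k = i then 0 else k))"
proof -
  define s where "s k = (if k = 0 then i else if k = i then 0 else k)" for k
  have s: "s k < n" if "k < n" for k using that i by (auto simp: s_def)
  have ss: "s (s k) = k" for k by (auto simp: s_def)
  define A where "A k l = (if l = s k then 1 else 0 :: 'a)" for k l
  define F where "F k = (if k < n then (\<Sum>j<n. mconst (A k j) * mvar j) + mconst 0 else 0)" for k
  have AA: "(\<Sum>k<n. A i k * A k j) = (if i = j then 1 else 0)" if "i < n" "j < n" for i j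
  proof -
    have "(\<Sum>k<n. A i k * A k j) = (\<Sum>k<n. if k = s i then A k j else 0)"
      by (intro sum.cong) (auto simp: A_def)
    then show ?thesis using s[OF that(1)] by (auto simp: A_def ss)
  qed
  have A: "A k l \<in> Fq q" for k l using q_ge by (simp add: A_def Fq_def)
  have "F \<in> affine_maps n q"
    unfolding affine_maps_def using A AA q_ge
    by (intro CollectI exI[of _ A] exI[of _ "\<lambda>_. 0"]) (auto simp: F_def Fq_def)
  then have "induced n F \<in> tame" by (auto simp: tame_def intro: TA.aff)
  moreover have "induced n F x = (\<lambda>k\<in>{..<n}. x (s k))" if x: "x \<in> Pts n" for x
  proof (rule Pts_eqI)
    fix k assume k: "k < n"
    have "ev (F k) x = (\<Sum>j<n. A k j * x j)"
      using k by (simp add: F_def)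
    also have "\<dots> = (\<Sum>j<n. if j = s k then x j else 0)"
      by (intro sum.cong) (auto simp: A_def)
    also have "\<dots> = x (s k)" using s[OF k] by simp
    finally show "induced n F x k = (\<lambda>k\<in>{..<n}. x (s k)) k"
      using k x unfolding induced_apply[OF x k] by simp
  qed (use x in auto)
  ultimately show ?thesis unfolding s_def by blast
qed

text \<open>\<open>h\<close> adds \<open>c\<close> to the \<open>i\<close>-th coordinate on the line through \<open>p\<close> in direction \<open>i\<close>, does the
  same equivariantly on the conjugate lines, and fixes all other points; \<open>p i\<close> is irrelevant.\<close>

definition elem_on :: "nat \<Rightarrow> (nat \<Rightarrow> 'a) \<Rightarrow> 'a \<Rightarrow> ((nat \<Rightarrow> 'a) \<Rightarrow> nat \<Rightarrow> 'a) \<Rightarrow> bool" where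
  "elem_on i p c h \<longleftrightarrow> (\<forall>x\<in>Pts n.
     (\<forall>j. (\<forall>l<n. l \<noteq> i \<longrightarrow> x l = fr j (p l)) \<longrightarrow> h x = x(i := x i + fr j c)) \<and>
     ((\<forall>j. \<exists>l<n. l \<noteq> i \<and> x l \<noteq> fr j (p l)) \<longrightarrow> h x = x))"

lemma upd_Pts [simp]: "x \<in> Pts n \<Longrightarrow> k < n \<Longrightarrow> x(k := y) \<in> Pts n"
  by (auto simp: Pts_def PiE_def extensional_def)

text \<open>In a triangular map only the coordinate 0 may depend on all the others, so this
  direction is handled directly. The hypothesis says that \<open>c\<close> lies in the field
  generated by the coordinates of \<open>p\<close> other than this one, which is what interpolation
  over F_q requires.\<close>

lemma elementary_first:
  assumes c: "\<And>j. \<forall>l<n. l \<noteq> 0 \<longrightarrow> fr j (p l) = p l \<Longrightarrow> fr j c = c"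
  shows "\<exists>h\<in>tame. elem_on 0 p c h"
proof -
  have V: "(\<forall>l\<in>{Suc 0..<n}. P l) \<longleftrightarrow> (\<forall>l<n. l \<noteq> 0 \<longrightarrow> P l)" for P by auto
  have E: "(\<exists>l\<in>{Suc 0..<n}. P l) \<longleftrightarrow> (\<exists>l<n. l \<noteq> 0 \<and> P l)" for P
    by (metis Suc_leI atLeastLessThan_iff neq0_conv not_less_eq_eq zero_le)
  obtain f where f: "poly_over (Fq q) {Suc 0..<n} f"
    "\<And>x j. \<forall>l<n. l \<noteq> 0 \<longrightarrow> x l = fr j (p l) \<Longrightarrow> ev f x = fr j c"
    "\<And>x. \<forall>j. \<exists>l<n. l \<noteq> 0 \<and> x l \<noteq> fr j (p l) \<Longrightarrow> ev f x = 0"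
    using equivariant_interpolation[of "{Suc 0..<n}" p c] c unfolding V E by blast
  define F where "F k = (if k < n then mconst 1 * mvar k + (if k = 0 then f else 0) else 0)" for k
  have "F \<in> triangular_maps n q"
    unfolding triangular_maps_def using f(1) poly_over_0[OF Fq_ring]
    by (intro CollectI exI[of _ "\<lambda>_. 1"] exI[of _ "\<lambda>k. if k = 0 then f else 0"])
       (auto simp: F_def Fq_def)
  then have "induced n F \<in> tame" by (auto simp: tame_def intro: TA.tri)
  moreover have ind: "induced n F x = x(0 := x 0 + ev f x)" if x: "x \<in> Pts n" for x
  proof (rule Pts_eqI)
    show "x(0 := x 0 + ev f x) \<in> Pts n" using x n_ge by simp
    show "induced n F x k = (x(0 := x 0 + ev f x)) k" if "k < n" for k
      using that x by (simp add: F_def)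
  qed (use x in auto)
  have "elem_on 0 p c (induced n F)"
    unfolding elem_on_def using f(2,3) by (auto simp: ind)
  ultimately show ?thesis by blast
qed

text \<open>Obtained from direction 0 by conjugating with the exchange of the coordinates 0 and
  \<open>i\<close>.\<close>

lemma elementary:
  assumes i: "i < n" and c: "\<And>j. \<forall>l<n. l \<noteq> i \<longrightarrow> fr j (p l) = p l \<Longrightarrow> fr j c = c"
  shows "\<exists>h\<in>tame. elem_on i p c h"
proof -
  define s where "s k = (if k = 0 then i else if k = i then 0 else k)" for k
  have s: "s k < n" if "k < n" for k using that i by (auto simp: s_def)
  have ss [simp]: "s (s k) = k" for k by (auto simp: s_def)
  have si: "s k = i \<longleftrightarrow> k = 0" "s k = 0 \<longleftrightarrow> k = i" for k by (auto simp: s_def)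
  have all: "(\<forall>l<n. l \<noteq> 0 \<longrightarrow> P (s l)) \<longleftrightarrow> (\<forall>l<n. l \<noteq> i \<longrightarrow> P l)" for P
  proof (intro iffI allI impI)
    fix l assume "\<forall>l<n. l \<noteq> 0 \<longrightarrow> P (s l)" "l < n" "l \<noteq> i"
    then show "P l" using s[of l] si(2)[of l] by (auto dest!: spec[of _ "s l"])
  next
    fix l assume "\<forall>l<n. l \<noteq> i \<longrightarrow> P l" "l < n" "l \<noteq> 0"
    then show "P (s l)" using s[of l] si(1)[of l] by simp
  qed
  have ex: "(\<exists>l<n. l \<noteq> 0 \<and> P (s l)) \<longleftrightarrow> (\<exists>l<n. l \<noteq> i \<and> P l)" for P
    using all[of "\<lambda>l. \<not> P l"] by blast
  obtain w where w: "w \<in> tame" "\<And>x. x \<in> Pts n \<Longrightarrow> w x = (\<lambda>k\<in>{..<n}. x (s k))"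
    using swap_tame[OF i] unfolding s_def by blast
  have wP: "w x \<in> Pts n" if "x \<in> Pts n" for x using w that by simp
  have wl: "w x l = x (s l)" if "x \<in> Pts n" "l < n" for x l using w that by simp
  have "fr j c = c" if "\<forall>l<n. l \<noteq> 0 \<longrightarrow> fr j (p (s l)) = p (s l)" for j
    using c all[of "\<lambda>l. fr j (p l) = p l"] that by blast
  from elementary_first[of "\<lambda>l. p (s l)" c, OF this] obtain g
    where g: "g \<in> tame" "elem_on 0 (\<lambda>l. p (s l)) c g" by blast
  obtain gw where gw: "gw \<in> tame" "\<And>x. x \<in> Pts n \<Longrightarrow> gw x = g (w x)"
    using H_obtain_comp[OF g(1) w(1)] by metis
  obtain h where h: "h \<in> tame" "\<And>x. x \<in> Pts n \<Longrightarrow> h x = w (gw x)"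
    using H_obtain_comp[OF w(1) gw(1)] by metis
  have "elem_on i p c h"
    unfolding elem_on_def
  proof (intro ballI conjI allI impI)
    fix x j assume x: "x \<in> Pts n" "\<forall>l<n. l \<noteq> i \<longrightarrow> x l = fr j (p l)"
    then have "\<forall>l<n. l \<noteq> 0 \<longrightarrow> x (s l) = fr j (p (s l))"
      using all[of "\<lambda>l. x l = fr j (p l)"] by blast
    then have 1: "g (w x) = (w x)(0 := w x 0 + fr j c)"
      using g(2) wP[OF x(1)] wl[OF x(1)] unfolding elem_on_def by simp
    have 2: "(w x)(0 := w x 0 + fr j c) \<in> Pts n" using wP[OF x(1)] n_ge by simp
    show "h x = x(i := x i + fr j c)"
    proof (rule Pts_eqI)
      show "h x \<in> Pts n" using H_closed h(1) x by blast
      show "x(i := x i + fr j c) \<in> Pts n" using x i by simp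
      fix k assume k: "k < n"
      have "h x k = ((w x)(0 := w x 0 + fr j c)) (s k)"
        using h(2)[OF x(1)] gw(2)[OF x(1)] 1 wl[OF 2 k] by simp
      also have "\<dots> = (x(i := x i + fr j c)) k"
        using wl[OF x(1) s[OF k]] wl[OF x(1), of 0] n_ge si(2)[of k] by (simp add: s_def)
      finally show "h x k = (x(i := x i + fr j c)) k" .
    qed
  next
    fix x assume x: "x \<in> Pts n" "\<forall>j. \<exists>l<n. l \<noteq> i \<and> x l \<noteq> fr j (p l)"
    have "\<exists>l<n. l \<noteq> 0 \<and> w x l \<noteq> fr j (p (s l))" for j
    proof -
      have "\<exists>l<n. l \<noteq> 0 \<and> x (s l) \<noteq> fr j (p (s l))"
        using x(2) ex[of "\<lambda>l. x l \<noteq> fr j (p l)"] by blast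
      then show ?thesis using wl[OF x(1)] by auto
    qed
    then have gwx: "g (w x) = w x" using g(2) wP[OF x(1)] unfolding elem_on_def by blast
    show "h x = x"
    proof (rule Pts_eqI)
      show "h x \<in> Pts n" using H_closed h(1) x by blast
      show "h x k = x k" if "k < n" for k
        using h(2)[OF x(1)] gw(2)[OF x(1)] gwx wl[OF wP[OF x(1)] that] wl[OF x(1) s[OF that]] by simp
    qed (rule x)
  qed
  then show ?thesis using h(1) by blast
qed

end

section \<open>The tame group contains enough 3-cycles\<close>

context tame_group begin

definition pt :: "'a \<Rightarrow> 'a \<Rightarrow> 'a \<Rightarrow> nat \<Rightarrow> 'a" where
  "pt u v w = (\<lambda>i\<in>{..<n}. if i = 0 then u else if i = 1 then v else if i = 2 then w else 0)"

lemma pt_Pts [simp]: "pt u v w \<in> Pts n"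
  by (simp add: pt_def)

lemma pt_apply [simp]: "pt u v w 0 = u" "pt u v w (Suc 0) = v" "pt u v w 2 = w"
  "i < n \<Longrightarrow> i > 2 \<Longrightarrow> pt u v w i = 0"
  using n_ge by (simp_all add: pt_def)

lemma actp_pt: "actp t (pt u v w) = pt (fr t u) (fr t v) (fr t w)"
  by (rule Pts_eqI) (auto simp: pt_def)

lemma pt_upd:
  "(pt u v w)(0 := y) = pt y v w"
  "(pt u v w)(Suc 0 := y) = pt u y w"
  "(pt u v w)(2 := y) = pt u v y"
  using n_ge by (auto simp: pt_def fun_eq_iff)

lemma orb_coord:
  assumes "x \<in> Pts n" "y \<in> Pts n" "orb x = orb y"
  shows "\<exists>t. y = actp t x"
  using assms orb_eq_iff by blast

lemma fr_single_period: "\<exists>r>0. r dvd m \<and> (\<forall>j. fr j y = y \<longleftrightarrow> r dvd j)"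
  by (rule fr_period[of "{()}" "\<lambda>_. y"]) auto

lemma fr_eq_0_iff [simp]: "fr t x = 0 \<longleftrightarrow> x = 0"
  using fr_eq_iff[of t x 0] by simp

lemma orb_pt:
  assumes "orb (pt u v w) = orb (pt u' v' w')"
  shows "u = 0 \<longleftrightarrow> u' = 0" "v = 0 \<longleftrightarrow> v' = 0" "w = 0 \<longleftrightarrow> w' = 0"
proof -
  obtain t where "pt u' v' w' = pt (fr t u) (fr t v) (fr t w)"
    using orb_coord[OF _ _ assms] by (auto simp: actp_pt)
  then have "u' = fr t u" "v' = fr t v" "w' = fr t w"
    by (metis pt_apply(1), metis pt_apply(2), metis pt_apply(3))
  then show "u = 0 \<longleftrightarrow> u' = 0" "v = 0 \<longleftrightarrow> v' = 0" "w = 0 \<longleftrightarrow> w' = 0" by simp_all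
qed

text \<open>The hypothesis \<open>stab\<close> expresses that the coordinate \<open>x l\<close>
  generates the field of definition of \<open>x\<close>; the conjugates of \<open>x\<close> are then
  told apart by this coordinate.\<close>

lemma actp_eq_if_coord:
  assumes x: "x \<in> Pts n" and stab: "\<And>t. fr t (x l) = x l \<Longrightarrow> actp t x = x"
    and eq: "fr s (x l) = fr t (x l)"
  shows "actp s x = actp t x"
proof -
  have *: "actp i x = actp j x" if "i \<le> j" "fr i (x l) = fr j (x l)" for i j
  proof -
    have "fr i (fr (j - i) (x l)) = fr i (x l)"
      using that unfolding fr_comp[symmetric] by simp
    then have "actp (j - i) x = x" using stab by simp
    then show ?thesis using act_add[OF x, of i "j - i"] that(1) by simp
  qed
  show ?thesis using *[of s t] *[of t s] eq by (metis linear)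
qed

text \<open>The maps \<open>f\<close> and \<open>g\<close> change \<open>x\<close> along the
  directions \<open>i\<close> and \<open>j\<close>. Both keep the coordinate \<open>l\<close>, which
  generates the field of definition of \<open>x\<close>, so conjugates of the two lines meet only in
  conjugates of \<open>x\<close>, and the commutator is a 3-cycle. The targets \<open>y\<close> and
  \<open>z\<close> have to lie in the same field.\<close>

lemma corner:
  assumes x: "x \<in> Pts n" and ijl: "i < n" "j < n" "l < n" "i \<noteq> j" "l \<noteq> i" "l \<noteq> j"
    and stab: "\<And>t. fr t (x l) = x l \<Longrightarrow> actp t x = x"
    and y: "y \<noteq> x i" "\<And>t. actp t x = x \<Longrightarrow> fr t y = y"
    and z: "z \<noteq> x j" "\<And>t. actp t x = x \<Longrightarrow> fr t z = z"
  shows "T x (x(i := y)) (x(j := z))"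
proof -
  have fixed: "fr t (x k) = x k" if "actp t x = x" "k < n" for t k
    using that actp_apply[of k t x] by simp
  have elem: "\<exists>h\<in>tame. elem_on k x (u - x k) h"
    if "k < n" "l \<noteq> k" "\<And>t. actp t x = x \<Longrightarrow> fr t u = u" for k u
  proof (rule elementary[OF that(1)])
    fix t assume "\<forall>l<n. l \<noteq> k \<longrightarrow> fr t (x l) = x l"
    then have "actp t x = x" using stab that(2) ijl(3) by blast
    then show "fr t (u - x k) = u - x k" using fixed that by simp
  qed
  obtain f where f: "f \<in> tame" "elem_on i x (y - x i) f" using elem[of i y] ijl y by blast
  obtain g where g: "g \<in> tame" "elem_on j x (z - x j) g" using elem[of j z] ijl z by blast
  have at_x: "h x = x(k := u)" if "elem_on k x (u - x k) h" for h k u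
  proof -
    have "\<forall>l<n. l \<noteq> k \<longrightarrow> x l = fr 0 (x l)" by simp
    then have "h x = x(k := x k + fr 0 (u - x k))"
      using that x unfolding elem_on_def by blast
    then show ?thesis by simp
  qed
  have fx: "f x = x(i := y)" and gx: "g x = x(j := z)" using at_x f g by blast+
  have ne: "orb (x(k := u)) \<noteq> orb x" if k: "k < n" "l \<noteq> k" "u \<noteq> x k" for k u
  proof
    assume "orb (x(k := u)) = orb x"
    then obtain t where t: "x(k := u) = actp t x"
      using orb_coord[OF x upd_Pts[OF x k(1)]] by metis
    have "fr t (x l) = x l"
      using fun_cong[OF t, of l] k(2) ijl(3) by simp
    then have "x(k := u) = x" using stab t by simp
    then show False using k(3) by (metis fun_upd_same)
  qed
  have "T x (f x) (g x)"
  proof (rule T_commutator[OF f(1) g(1) x])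
    show "orb (f x) \<noteq> orb x" using ne ijl y fx by simp
    show "orb (g x) \<noteq> orb x" using ne ijl z gx by simp
    fix p assume p: "p \<in> Pts n" "f p \<noteq> p" "g p \<noteq> p"
    obtain s where s: "\<forall>l<n. l \<noteq> i \<longrightarrow> p l = fr s (x l)"
      using f(2) p unfolding elem_on_def by blast
    obtain t where t: "\<forall>l<n. l \<noteq> j \<longrightarrow> p l = fr t (x l)"
      using g(2) p unfolding elem_on_def by blast
    have "fr s (x l) = fr t (x l)" using s t ijl by metis
    then have eq: "actp s x = actp t x" using actp_eq_if_coord[OF x stab] by blast
    have "p = actp s x"
    proof (rule Pts_eqI[OF p(1)])
      show "p k = actp s x k" if "k < n" for k
      proof (cases "k = i")
        case True
        then have "p k = actp t x k" using t that ijl by simp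
        then show ?thesis using eq by simp
      qed (use s that in simp)
    qed simp
    then show "orb p = orb x" using x by simp
  qed
  then show ?thesis using fx gx by simp
qed

end

section \<open>The seed in degree \<open>d\<close>, built from a generator \<open>g\<close> of the
  field of order q^d\<close>

locale tame_generator = tame_group q m ty n for q m n and ty :: "'a::{field,finite} itself" +
  fixes d :: nat and g :: 'a
  assumes d_dvd: "d dvd m" and g_nz: "g \<noteq> 0" and g_period: "fr j g = g \<longleftrightarrow> d dvd j"
begin

lemma fr_g [simp]: "d dvd j \<Longrightarrow> fr j g = g"
  using g_period by blast

lemma fr_g_iff: "fr j (fr 1 g) = fr 1 g \<longleftrightarrow> d dvd j"
proof -
  have "fr j (fr 1 g) = fr 1 (fr j g)" unfolding fr_comp[symmetric] by (simp add: add.commute)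
  then show ?thesis using g_period by simp
qed

lemma pt_seed: "u \<in> {0, g, fr 1 g} \<Longrightarrow> d dvd t \<Longrightarrow> fr t u = u"
  using g_period fr_g_iff by auto

text \<open>Every nonzero entry from \<open>{0, g, fr 1 g}\<close> has period exactly
  \<open>d\<close>, so any nonzero coordinate can act as the unchanged one in
  \<open>corner\<close>.\<close>

lemma corner_pt:
  assumes uvw: "{u, v, w} \<subseteq> {0, g, fr 1 g}" and y: "y \<in> {0, g, fr 1 g}" "z \<in> {0, g, fr 1 g}"
  shows "w \<noteq> 0 \<Longrightarrow> y \<noteq> u \<Longrightarrow> z \<noteq> v \<Longrightarrow> T (pt u v w) (pt y v w) (pt u z w)"
    "v \<noteq> 0 \<Longrightarrow> y \<noteq> u \<Longrightarrow> z \<noteq> w \<Longrightarrow> T (pt u v w) (pt y v w) (pt u v z)"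
    "u \<noteq> 0 \<Longrightarrow> y \<noteq> v \<Longrightarrow> z \<noteq> w \<Longrightarrow> T (pt u v w) (pt u y w) (pt u v z)"
proof -
  have per: "fr t a = a \<longleftrightarrow> d dvd t" if "a \<in> {0, g, fr 1 g}" "a \<noteq> 0" for a t
    using that g_period fr_g_iff by auto
  have stab: "actp t (pt u v w) = pt u v w" if "d dvd t" for t
    using uvw pt_seed[OF _ that] by (simp add: actp_pt)
  have stab': "d dvd t" if "actp t (pt u v w) = pt u v w" "u \<noteq> 0 \<or> v \<noteq> 0 \<or> w \<noteq> 0" for t
  proof -
    have "fr t u = u" "fr t v = v" "fr t w = w"
      using that(1) unfolding actp_pt
      by (metis pt_apply(1), metis pt_apply(2), metis pt_apply(3))
    then show ?thesis using per uvw that(2) by auto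
  qed
  note st = pt_seed[OF y(1)] pt_seed[OF y(2)]
  have n3: "0 < n" "Suc 0 < n" "2 < n" using n_ge by auto
  show "T (pt u v w) (pt y v w) (pt u z w)" if "w \<noteq> 0" "y \<noteq> u" "z \<noteq> v"
    using corner[of "pt u v w" 0 "Suc 0" 2 y z] n3 that st stab stab' per[of w] uvw
    by (simp add: pt_upd)
  show "T (pt u v w) (pt y v w) (pt u v z)" if "v \<noteq> 0" "y \<noteq> u" "z \<noteq> w"
    using corner[of "pt u v w" 0 2 "Suc 0" y z] n3 that st stab stab' per[of v] uvw
    by (simp add: pt_upd)
  show "T (pt u v w) (pt u y w) (pt u v z)" if "u \<noteq> 0" "y \<noteq> v" "z \<noteq> w"
    using corner[of "pt u v w" "Suc 0" 2 0 y z] n3 that st stab stab' per[of u] uvw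
    by (simp add: pt_upd)
qed

text \<open>The first two seeds are corners at (g,g,g); the third is a corner at (0,g,g). Their
  orbits differ because conjugation preserves the pattern of vanishing coordinates.\<close>

sublocale seeded_perms "Pts n" actp m tame "pt g g g" "pt 0 g g" "pt g 0 g" "pt g g 0" "pt 0 0 g"
proof
  show "T (pt g g g) (pt 0 g g) (pt g 0 g)" using corner_pt(1)[of g g g 0 0] g_nz by simp
  show "T (pt g g g) (pt 0 g g) (pt g g 0)" using corner_pt(2)[of g g g 0 0] g_nz by simp
  have "T (pt 0 g g) (pt g g g) (pt 0 0 g)" using corner_pt(1)[of 0 g g g 0] g_nz by simp
  then show "T (pt g g g) (pt 0 g g) (pt 0 0 g)" using T_perms by blast
  show "orb (pt g 0 g) \<noteq> orb (pt g g 0)" "orb (pt g 0 g) \<noteq> orb (pt 0 0 g)"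
    "orb (pt g g 0) \<noteq> orb (pt 0 0 g)"
    using orb_pt g_nz by blast+
qed

text \<open>The point (g,g,0) is changed to its conjugate (g^q,g^q,0) one coordinate at a time, each
  change being the edge of a corner. The third coordinate stays 0 on the way, which keeps the path
  away from the orbits of both base points, as \<open>T_closed\<close> demands.\<close>

lemma twist: "T (pt g g g) (pt 0 g g) (actp 1 (pt g g 0))"
proof (cases "fr 1 g = g")
  case True
  then show ?thesis using seed(2) by (simp only: actp_pt fr_0)
next
  case False
  have nz: "fr 1 g \<noteq> 0" using g_nz by simp
  have "T (pt g g 0) (pt g (fr 1 g) 0) (pt g g g)"
    using corner_pt(3)[of g g 0 "fr 1 g" g] g_nz False by simp
  moreover have ne: "orb (pt u v 0) \<noteq> orb (pt g g g)" "orb (pt u v 0) \<noteq> orb (pt 0 g g)" for u v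
    using orb_pt(3) g_nz by blast+
  ultimately have 1: "T (pt g g g) (pt 0 g g) (pt g (fr 1 g) 0)"
    using T_closed[of "pt g g 0"] seed(2) by blast
  have "T (pt g (fr 1 g) 0) (pt (fr 1 g) (fr 1 g) 0) (pt g (fr 1 g) g)"
    using corner_pt(2)[of g "fr 1 g" 0 "fr 1 g" g] g_nz nz False by simp
  then have "T (pt g g g) (pt 0 g g) (pt (fr 1 g) (fr 1 g) 0)"
    using T_closed[of "pt g (fr 1 g) 0"] 1 ne by blast
  then show ?thesis by (simp only: actp_pt fr_0)
qed

text \<open>One of (g,g,g), (0,g,g), (g,0,g) is fixed by the elementary map and serves in
  \<open>linked_step\<close>. If all three lay on conjugates of the line through \<open>x\<close>,
  some coordinate of \<open>x\<close> unaffected by the move would be conjugate to both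
  \<open>g\<close> and 0.\<close>

lemma linked_elementary:
  assumes x: "x \<in> Pts n" "linked x" and i: "i < n"
    and c: "\<And>t. \<forall>l<n. l \<noteq> i \<longrightarrow> fr t (x l) = x l \<Longrightarrow> fr t c = c"
  shows "linked (x(i := x i + c))"
proof -
  obtain h where h: "h \<in> tame" "elem_on i x c h" using elementary[OF i c] by blast
  have "\<forall>l<n. l \<noteq> i \<longrightarrow> x l = fr 0 (x l)" by simp
  then have "h x = x(i := x i + fr 0 c)"
    using h(2) x unfolding elem_on_def by blast
  then have hx: "h x = x(i := x i + c)" by simp
  have "\<exists>s. (s = pt g g g \<or> s = pt 0 g g \<or> s = pt g 0 g) \<and> (\<forall>t. \<exists>l<n. l \<noteq> i \<and> s l \<noteq> fr t (x l))"
  proof (rule ccontr)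
    assume "\<not> ?thesis"
    then have *: "\<exists>t. \<forall>l<n. l \<noteq> i \<longrightarrow> s l = fr t (x l)"
      if "s = pt g g g \<or> s = pt 0 g g \<or> s = pt g 0 g" for s using that by blast
    obtain t1 where t1: "\<forall>l<n. l \<noteq> i \<longrightarrow> pt g g g l = fr t1 (x l)" using * by blast
    obtain t2 where t2: "\<forall>l<n. l \<noteq> i \<longrightarrow> pt 0 g g l = fr t2 (x l)" using * by blast
    obtain t3 where t3: "\<forall>l<n. l \<noteq> i \<longrightarrow> pt g 0 g l = fr t3 (x l)" using * by blast
    have n3: "0 < n" "Suc 0 < n" using n_ge by auto
    show False
    proof (cases "i = 0")
      case True
      have "g = fr t1 (x (Suc 0))" "0 = fr t3 (x (Suc 0))"
        using t1[rule_format, OF n3(2)] t3[rule_format, OF n3(2)] True by simp_all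
      then show False using g_nz by (metis fr_0 fr_eq_iff)
    next
      case False
      have "g = fr t1 (x 0)" "0 = fr t2 (x 0)"
        using t1[rule_format, OF n3(1)] t2[rule_format, OF n3(1)] False by simp_all
      then show False using g_nz by (metis fr_0 fr_eq_iff)
    qed
  qed
  then obtain s where s: "s = pt g g g \<or> s = pt 0 g g \<or> s = pt g 0 g"
    "\<forall>t. \<exists>l<n. l \<noteq> i \<and> s l \<noteq> fr t (x l)" by blast
  have sP: "s \<in> Pts n" using s(1) by auto
  then have "h s = s" using h(2) s(2) unfolding elem_on_def by blast
  moreover have "orb s \<noteq> orb x"
  proof
    assume "orb s = orb x"
    then obtain t where "s = actp t x" using orb_coord[OF x(1) sP] by auto
    then show False using s(2) by auto
  qed
  ultimately show ?thesis
    using linked_step[OF twist x h(1) s(1)] hx by simp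
qed

text \<open>The translation by \<open>-c\<close> on the same line undoes the move. A point may thus
  be simplified by elementary moves, and linkedness is pulled back from the result.\<close>

lemma linked_back:
  assumes x: "x \<in> pts d" and i: "i < n"
    and c: "\<And>t. \<forall>l<n. l \<noteq> i \<longrightarrow> fr t (x l) = x l \<Longrightarrow> fr t c = c"
  shows "x(i := x i + c) \<in> pts d" and "linked (x(i := x i + c)) \<Longrightarrow> linked x"
proof -
  have xP: "x \<in> Pts n" using x by (rule pts_X)
  obtain h where h: "h \<in> tame" "elem_on i x c h" using elementary[OF i c] by blast
  have "\<forall>l<n. l \<noteq> i \<longrightarrow> x l = fr 0 (x l)" by simp
  then have "h x = x(i := x i + fr 0 c)"
    using h(2) xP unfolding elem_on_def by blast
  then show "x(i := x i + c) \<in> pts d"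
    using pts_equivariant[OF equivariant_H[OF h(1)] x] by simp
  let ?y = "x(i := x i + c)"
  assume y: "linked ?y"
  have "fr t (- c) = - c" if "\<forall>l<n. l \<noteq> i \<longrightarrow> fr t (?y l) = ?y l" for t
    using c[of t] that by simp
  from linked_elementary[OF upd_Pts[OF xP i] y i this]
  have "linked (?y(i := ?y i + - c))" .
  then show "linked x" by simp
qed

lemma pts_fixed:
  assumes "x \<in> pts d" "d dvd t" "l < n" shows "fr t (x l) = x l"
proof -
  have "actp t x = x" using assms(1,2) by (simp add: pts_def)
  then have "actp t x l = x l" by simp
  then show ?thesis unfolding actp_apply[OF assms(3)] .
qed

text \<open>A coordinate equal to \<open>g\<close> generates the whole field of degree
  \<open>d\<close>, so every other coordinate can be set to its value in (g,g,g,0,...) one after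
  another.\<close>

lemma linked_if_first:
  assumes "x \<in> pts d" "x 0 = g"
  shows "linked x"
  using assms
proof (induction "card {l. l < n \<and> x l \<noteq> pt g g g l}" arbitrary: x rule: less_induct)
  case less
  show ?case
  proof (cases "\<forall>l<n. x l = pt g g g l")
    case True
    then have "x = pt g g g" using pts_X[OF less.prems(1)] by (intro Pts_eqI) auto
    then show ?thesis by (simp add: linked_def)
  next
    case False
    then obtain l where l: "l < n" "x l \<noteq> pt g g g l" by blast
    then have l0: "l \<noteq> 0" using less.prems(2) by (metis pt_apply(1))
    define c where "c = pt g g g l - x l"
    have c: "fr t c = c" if "\<forall>k<n. k \<noteq> l \<longrightarrow> fr t (x k) = x k" for t
    proof -
      have "0 < n" using n_ge by simp
      then have "fr t g = g" using that[rule_format, of 0] l0 less.prems(2) by simp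
      then have "d dvd t" using g_period by blast
      moreover have "pt g g g l = g \<or> pt g g g l = 0" using l by (simp add: pt_def)
      ultimately show ?thesis
        using pts_fixed[OF less.prems(1) _ l(1)] unfolding c_def by auto
    qed
    let ?y = "x(l := x l + c)"
    have yl: "?y l = pt g g g l" by (simp add: c_def)
    have "{k. k < n \<and> ?y k \<noteq> pt g g g k} \<subset> {k. k < n \<and> x k \<noteq> pt g g g k}"
      using l yl by (auto split: if_splits)
    then have "card {k. k < n \<and> ?y k \<noteq> pt g g g k} < card {k. k < n \<and> x k \<noteq> pt g g g k}"
      by (intro psubset_card_mono) auto
    moreover have "?y 0 = g" using l0 less.prems(2) by simp
    ultimately have "linked ?y"
      using less.hyps linked_back(1)[OF less.prems(1) l(1) c] by blast
    then show ?thesis using linked_back(2)[OF less.prems(1) l(1) c] by blast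
  qed
qed

text \<open>A generating coordinate other than 0 allows the coordinate 0 to be set to
  \<open>g\<close>. If the generating coordinate is 0 itself, \<open>g\<close> is first placed in
  coordinate 1, which then takes over as generating coordinate.\<close>

lemma linked_if_generator:
  assumes x: "x \<in> pts d" and i: "i < n" and per: "\<And>t. fr t (x i) = x i \<longleftrightarrow> d dvd t"
  shows "linked x"
proof -
  have to_g: "x(k := g) \<in> pts d \<and> (linked (x(k := g)) \<longrightarrow> linked x)"
    if a: "x \<in> pts d" "i < n" "\<And>t. fr t (x i) = x i \<longleftrightarrow> d dvd t" "k < n" "k \<noteq> i" for x i k
  proof -
    have "fr t (g - x k) = g - x k" if "\<forall>l<n. l \<noteq> k \<longrightarrow> fr t (x l) = x l" for t
    proof -
      have "d dvd t" using that a(2,3,5) by metis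
      then show ?thesis using pts_fixed[OF a(1) _ a(4)] by simp
    qed
    from linked_back[OF a(1,4) this] show ?thesis by simp
  qed
  have pos: "0 < n" "Suc 0 < n" using n_ge by auto
  have *: "linked x" if "x \<in> pts d" "i < n" "\<And>t. fr t (x i) = x i \<longleftrightarrow> d dvd t" "i \<noteq> 0" for x i
    using to_g[OF that(1-3) pos(1)] that(4) linked_if_first[of "x(0 := g)"] by simp
  show ?thesis
  proof (cases "i = 0")
    case False
    then show ?thesis using * x i per by blast
  next
    case True
    have "x(Suc 0 := g) \<in> pts d" "linked (x(Suc 0 := g)) \<longrightarrow> linked x"
      using to_g[OF x i per pos(2)] True by simp_all
    moreover have "linked (x(Suc 0 := g))"
      using *[of "x(Suc 0 := g)" "Suc 0"] calculation(1) pos(2) g_period by simp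
    ultimately show ?thesis by blast
  qed
qed

text \<open>If no coordinate generates the field of definition of \<open>x\<close>, pick a coordinate with field
  \<open>K\<close> and another one outside \<open>K\<close>. A translation of the latter by an element of \<open>K\<close> gives it a
  degree larger than that of \<open>K\<close>, because the fields of smaller degree have too few elements.\<close>

lemma pts_linked:
  assumes "x \<in> pts d" "i < n" "\<And>t. fr t (x i) = x i \<longleftrightarrow> r dvd t"
  shows "linked x"
  using assms
\<comment> \<open>The degree \<open>r\<close> of the chosen coordinate grows at each step, by
  passing to another coordinate, until it reaches \<open>d\<close>.\<close>
proof (induction "m - r" arbitrary: x i r rule: less_induct)
  case less
  note x = less.prems(1) and i = less.prems(2) and per = less.prems(3)
  have xP: "x \<in> Pts n" using x by (rule pts_X)
  have r_dvd_d: "r dvd d" using per pts_fixed[OF x dvd_refl i] by blast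
  then have r_dvd: "r dvd m" using d_dvd dvd_trans by blast
  show ?case
  proof (cases "r = d")
    case True
    then show ?thesis using linked_if_generator[OF x i] per by blast
  next
    case False
    have "\<exists>k<n. fr r (x k) \<noteq> x k"
    proof (rule ccontr)
      assume "\<not> ?thesis"
      then have "actp r x = x" using xP by (intro Pts_eqI) auto
      then have "d dvd r" using x by (simp add: pts_def)
      then show False using r_dvd_d False dvd_antisym by blast
    qed
    then obtain k where k: "k < n" "fr r (x k) \<noteq> x k" by blast
    have ki: "i \<noteq> k"
    proof
      assume "i = k"
      then show False using k(2) per[of r] by simp
    qed
    obtain c where c: "fr r c = c" "\<forall>j. 0 < j \<longrightarrow> j < r \<longrightarrow> fr j (x k + c) \<noteq> x k + c"
      using exists_large_period[OF r_dvd] by blast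
    have c_fix: "fr t c = c" if "\<forall>l<n. l \<noteq> k \<longrightarrow> fr t (x l) = x l" for t
    proof -
      have "r dvd t" using that i ki per by blast
      then show ?thesis using fr_fix_dvd c(1) by blast
    qed
    obtain s where s: "s > 0" "s dvd m" "\<And>j. fr j (x k + c) = x k + c \<longleftrightarrow> s dvd j"
      using fr_single_period by blast
    have "fr s (x k + c) = x k + c" unfolding s(3) by (rule dvd_refl)
    then have "\<not> s < r" using c(2) s(1) by blast
    \<comment> \<open>\<open>fr r\<close> fixes \<open>c\<close> but not \<open>x k\<close>, hence
      not their sum; the new degree is strictly larger.\<close>
    moreover have "s \<noteq> r"
    proof
      assume "s = r"
      then have "fr r (x k + c) = x k + c" unfolding s(3) by simp
      then show False using c(1) k(2) by simp
    qed
    moreover have "s \<le> m" using s(2) m_ge by (simp add: dvd_imp_le)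
    ultimately have less_m: "m - s < m - r" by linarith
    let ?y = "x(k := x k + c)"
    have "fr t (?y k) = ?y k \<longleftrightarrow> s dvd t" for t
      unfolding fun_upd_same by (rule s(3))
    from less.hyps[OF less_m linked_back(1)[OF x k(1) c_fix] k(1) this]
    have "linked ?y" by blast
    then show ?thesis using linked_back(2)[OF x k(1) c_fix] by blast
  qed
qed

lemma pts_pt:
  assumes "{u, v, w} \<subseteq> {0, g}" "u \<noteq> 0 \<or> v \<noteq> 0 \<or> w \<noteq> 0"
  shows "pt u v w \<in> pts d"
proof -
  have "actp t (pt u v w) = pt u v w \<longleftrightarrow> fr t u = u \<and> fr t v = v \<and> fr t w = w" for t
    unfolding actp_pt by (metis pt_apply(1) pt_apply(2) pt_apply(3))
  then show ?thesis using assms g_period by (auto simp: pts_def)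
qed

lemma base_pair:
  "\<exists>a b. a \<in> pts d \<and> b \<in> pts d \<and> orb a \<noteq> orb b \<and>
    (\<forall>w\<in>pts d. orb w \<noteq> orb a \<longrightarrow> orb w \<noteq> orb b \<longrightarrow> T a b w) \<and>
    (\<exists>x y. x \<in> pts d \<and> T a b x \<and> T a b y \<and> orb x \<noteq> orb y)"
proof (intro exI conjI ballI impI)
  show "pt g g g \<in> pts d" "pt 0 g g \<in> pts d" "pt g 0 g \<in> pts d"
    using pts_pt g_nz by simp_all
  show "orb (pt g g g) \<noteq> orb (pt 0 g g)" using T_orb[OF seed(1)] by blast
  show "T (pt g g g) (pt 0 g g) (pt g 0 g)" "T (pt g g g) (pt 0 g g) (pt g g 0)"
    "orb (pt g 0 g) \<noteq> orb (pt g g 0)" using seed seed_orb by blast+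
  fix w assume w: "w \<in> pts d" "orb w \<noteq> orb (pt g g g)" "orb w \<noteq> orb (pt 0 g g)"
  obtain r where "\<And>j. fr j (w 0) = w 0 \<longleftrightarrow> r dvd j"
    using fr_single_period by blast
  then have "linked w" using pts_linked[OF w(1), of 0 r] n_ge by simp
  then show "T (pt g g g) (pt 0 g g) w" using w by (simp add: linked_def)
qed

end

context tame_group begin

text \<open>The generator depends on \<open>d\<close>; the existential form hides it, so that all
  divisors of \<open>m\<close> can be treated together.\<close>

lemma base_pair_exists:
  assumes "d dvd m"
  shows "\<exists>a b. a \<in> pts d \<and> b \<in> pts d \<and> orb a \<noteq> orb b \<and>
    (\<forall>w\<in>pts d. orb w \<noteq> orb a \<longrightarrow> orb w \<noteq> orb b \<longrightarrow> T a b w) \<and>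
    (\<exists>x y. x \<in> pts d \<and> T a b x \<and> T a b y \<and> orb x \<noteq> orb y)"
proof -
  obtain g where g: "g \<noteq> 0" "\<And>j. fr j g = g \<longleftrightarrow> d dvd j"
    using exists_generator[OF assms] by blast
  interpret tame_generator q m n ty d g
    by unfold_locales (use assms g in auto)
  show ?thesis by (rule base_pair)
qed

section \<open>Counting the cosets\<close>

lemma equivariant_Mm: 
  assumes "h \<in> Mm n q" shows "equivariant h"
proof -
  obtain F where F: "F \<in> MA n q" "h = induced n F" and bij: "h \<in> Bij (Pts n)"
    using assms by (auto simp: Mm_def)
  have "poly_over (Fq q) {..<n} (F i)" if "i < n" for i
    using F(1) that by (simp add: MA_def)
  then show ?thesis
    unfolding equivariant_def using F(2) bij induced_actp by (auto simp: Bij_def bij_betw_def)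
qed

theorem perm_index_le:
  "perm_index n (Mm n q :: ((nat \<Rightarrow> 'a) \<Rightarrow> (nat \<Rightarrow> 'a)) set) (induced n ` TA n q)
    \<le> 2 ^ sigma0 m * (\<Prod>d\<in>{d. d dvd m}. d)"
proof -
  let ?D = "{d. d dvd m}"
  let ?G = "BijGroup (Pts n :: (nat \<Rightarrow> 'a) set)\<lparr>carrier := Mm n q\<rparr>"
  have D: "finite ?D" "\<And>d. d \<in> ?D \<Longrightarrow> d > 0"
    using m_ge by (auto intro: Nat.gr0I)
  have cover: "Pts n = (\<Union>d\<in>?D. pts d)"
    using pts_exists pts_X by blast
  have "\<forall>d\<in>?D. \<exists>a b. a \<in> pts d \<and> b \<in> pts d \<and> orb a \<noteq> orb b \<and>
    (\<forall>w\<in>pts d. orb w \<noteq> orb a \<longrightarrow> orb w \<noteq> orb b \<longrightarrow> T a b w) \<and>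
    (\<exists>x y. x \<in> pts d \<and> T a b x \<and> T a b y \<and> orb x \<noteq> orb y)"
    using base_pair_exists by blast
  from bchoice[OF this] obtain a where "\<forall>d\<in>?D. \<exists>b. a d \<in> pts d \<and> b \<in> pts d \<and> orb (a d) \<noteq> orb b \<and>
    (\<forall>w\<in>pts d. orb w \<noteq> orb (a d) \<longrightarrow> orb w \<noteq> orb b \<longrightarrow> T (a d) b w) \<and>
    (\<exists>x y. x \<in> pts d \<and> T (a d) b x \<and> T (a d) b y \<and> orb x \<noteq> orb y)" by blast
  from bchoice[OF this] obtain b where "\<forall>d\<in>?D. a d \<in> pts d \<and> b d \<in> pts d \<and> orb (a d) \<noteq> orb (b d) \<and>
    (\<forall>w\<in>pts d. orb w \<noteq> orb (a d) \<longrightarrow> orb w \<noteq> orb (b d) \<longrightarrow> T (a d) (b d) w) \<and>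
    (\<exists>x y. x \<in> pts d \<and> T (a d) (b d) x \<and> T (a d) (b d) y \<and> orb x \<noteq> orb y)" by blast
  then have ab: "\<And>d. d \<in> ?D \<Longrightarrow> a d \<in> pts d" "\<And>d. d \<in> ?D \<Longrightarrow> b d \<in> pts d"
    "\<And>d. d \<in> ?D \<Longrightarrow> orb (a d) \<noteq> orb (b d)"
    "\<And>d w. d \<in> ?D \<Longrightarrow> w \<in> pts d \<Longrightarrow> orb w \<noteq> orb (a d) \<Longrightarrow> orb w \<noteq> orb (b d) \<Longrightarrow> T (a d) (b d) w"
    "\<And>d. d \<in> ?D \<Longrightarrow> \<exists>x y. x \<in> pts d \<and> T (a d) (b d) x \<and> T (a d) (b d) y \<and> orb x \<noteq> orb y"
    by blast+
  \<comment> \<open>The normal forms are collected among all equivariant maps; for an upper bound on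
    the index it is enough that every coset comes from one of them.\<close>
  define R where "R = {f \<in> extensional (Pts n). equivariant f \<and> (\<forall>d\<in>?D. reduced (a d) (b d) d f)}"
  have R: "finite R" "card R \<le> (\<Prod>d\<in>?D. 2 * d)"
    using card_reduced_le[OF D(1) cover D(2) ab(1-3)] by (auto simp: R_def)
  let ?cos = "\<lambda>g. (\<lambda>k. compose (Pts n) k g) ` tame"
  have coset: "tame #>\<^bsub>?G\<^esub> g = ?cos g" if "g \<in> Mm n q" for g
  proof -
    have "k \<otimes>\<^bsub>?G\<^esub> g = compose (Pts n) k g" if "k \<in> tame" for k
      using that \<open>g \<in> Mm n q\<close> tame_Bij by (auto simp: BijGroup_def Mm_def)
    then show ?thesis by (auto simp: r_coset_def)
  qed
  have ne: "tame \<noteq> {}"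
    using ab(5)[of 1] by (auto simp: T_def)
  have "?cos g \<in> ?cos ` R" if g: "g \<in> Mm n q" for g
  proof -
    have eg: "equivariant g" using equivariant_Mm[OF g] .
    obtain h where h: "h \<in> tame" "\<forall>d\<in>?D. reduced (a d) (b d) d (\<lambda>p. h (g p))"
      using reduce_all[OF finite_Pts D(1) ne ab(1,2,4,5) eg] by blast
    obtain h' where h': "h' \<in> tame" "\<And>x. x \<in> Pts n \<Longrightarrow> h' (h x) = x"
      using H_obtain_inv[OF h(1)] by metis
    let ?r = "compose (Pts n) h g"
    have r: "?r x = h (g x)" if "x \<in> Pts n" for x
      using that by (simp add: compose_def)
    have gP: "g x \<in> Pts n" if "x \<in> Pts n" for x using eg that by (simp add: equivariant_def)
    have "equivariant ?r"
      using equivariant_comp[OF equivariant_H[OF h(1)] eg] r unfolding equivariant_def inj_on_def by simp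
    moreover have "reduced (a d) (b d) d ?r" if "d \<in> ?D" for d
    proof -
      have "b d \<in> Pts n" using ab(2)[OF that] by (rule pts_X)
      then show ?thesis using h(2) that r pts_X unfolding reduced_def by simp
    qed
    moreover have "?r \<in> extensional (Pts n)" by (simp add: compose_def)
    ultimately have "?r \<in> R" by (simp add: R_def)
    \<comment> \<open>Multiplying \<open>g\<close> on the left by an element of the tame group
      leaves its right coset unchanged; \<open>h'\<close> provides the inverse direction.\<close>
    moreover have "?cos g = ?cos ?r"
    proof (intro equalityI subsetI; elim imageE)
      fix f k assume f: "f = compose (Pts n) k g" and k: "k \<in> tame"
      have "f = compose (Pts n) (compose (Pts n) k h') ?r"
      proof
        fix x show "f x = compose (Pts n) (compose (Pts n) k h') ?r x"
          using f h'(2)[of "g x"] gP[of x] H_closed[OF h(1), of "g x"]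
          by (cases "x \<in> Pts n") (simp_all add: compose_def)
      qed
      then show "f \<in> ?cos ?r" using tame_compose[OF k h'(1)] by blast
    next
      fix f k assume f: "f = compose (Pts n) k ?r" and k: "k \<in> tame"
      have "f = compose (Pts n) (compose (Pts n) k h) g"
      proof
        fix x show "f x = compose (Pts n) (compose (Pts n) k h) g x"
          using f gP[of x] by (cases "x \<in> Pts n") (simp_all add: compose_def)
      qed
      then show "f \<in> ?cos g" using tame_compose[OF k h(1)] by blast
    qed
    ultimately show ?thesis by blast
  qed
  then have "rcosets\<^bsub>?G\<^esub> tame \<subseteq> ?cos ` R"
    using coset by (auto simp: RCOSETS_def)
  then have "card (rcosets\<^bsub>?G\<^esub> tame) \<le> card R"
    using R(1) by (meson card_image_le card_mono finite_imageI order.trans)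
  also have "\<dots> \<le> (\<Prod>d\<in>?D. 2 * d)" by (rule R(2))
  also have "\<dots> = 2 ^ sigma0 m * (\<Prod>d\<in>?D. d)"
    by (simp add: prod.distrib sigma0_def)
  finally show ?thesis by (simp add: perm_index_def tame_def)
qed

end

theorem mainTheorem5:
  fixes q m n :: nat
  assumes "n \<ge> 3" and "\<exists>p k. prime p \<and> k \<ge> 1 \<and> q = p ^ k" and "m \<ge> 1"
    and "card (UNIV :: 'a set) = q ^ m"
  shows "perm_index n (Mm n q :: ((nat \<Rightarrow> 'a::{field,finite}) \<Rightarrow> (nat \<Rightarrow> 'a)) set)
            (induced n ` TA n q)
         \<le> 2 ^ sigma0 m * (\<Prod>d\<in>{d. d dvd m}. d)"
proof -
  interpret tame_group q m "TYPE('a)" n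
    by unfold_locales (use assms in auto)
  show ?thesis by (rule perm_index_le)
qed

end
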